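(* For every $I\in\mathbb{S}$ let $g_I\in L^2\big((-\infty,0),(-w)^{-1}dw\big)$ be $\mathbb{R}_n$-valued. Assume that $f:\mathbb{R}^{n+1}_+\to\mathbb{R}_n$ is a function such that $$f(\mathbf{x})=\frac{1}{\sqrt{2\pi}}\int_{-\infty}^{0}e^{\mathbf{x}w}g_I(w)\,dw\qquad\text{for every }I\in\mathbb{S}\text{ and every }\mathbf{x}=u+Iv,\ u>0,\ v\in\mathbb{R}.$$ Then $f\in\mathcal{B}^2_{\mathrm{slice}}(\mathbb{R}^{n+1}_+)$, and for every $I\in\mathbb{S}$ $$\|f\|^2_{\mathcal{B}^2_{\mathrm{slice}}(\mathbb{R}^{n+1}_+)}\le\frac12\int_{-\infty}^{0}|g_I(w)|^2\,\frac{dw}{-w}.$$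
   Context: $\mathbb{R}_n$ is the real Clifford algebra generated by $\mathbf{e}_1,\dots,\mathbf{e}_n$ with $\mathbf{e}_r\mathbf{e}_s+\mathbf{e}_s\mathbf{e}_r=-2\delta_{rs}$; its elements are $a=\sum_A a_A\mathbf{e}_A$ ($a_A\in\mathbb{R}$, $A\subseteq\{1,\dots,n\}$ ordered, $\mathbf{e}_A$ the corresponding ordered product, $\mathbf{e}_\varnothing=1$), with norm $|a|=(\sum_A a_A^2)^{1/2}$. $\mathbb{R}^{n+1}$ is identified with the set of paravectors $x_0+x_1\mathbf{e}_1+\dots+x_n\mathbf{e}_n$. $\mathbb{S}=\{x_1\mathbf{e}_1+\dots+x_n\mathbf{e}_n:\ x_1^2+\dots+x_n^2=1\}$, so $I^2=-1$ for $I\in\mathbb{S}$; $L_I=\mathbb{R}+I\mathbb{R}\cong\mathbb{C}$. For $U\subseteq\mathbb{R}^{n+1}$ open, a real differentiable $f:U\to\mathbb{R}_n$ is left slice monogenic, written $f\in\mathcal{SM}_l(U)$, if for every $I\in\mathbb{S}$, $\frac12\left(\frac{\partial}{\partial u}+I\frac{\partial}{\partial v}\right)f(u+Iv)=0$ on $U\cap L_I$. $\mathbb{R}^{n+1}_+=\{u+Iv:\ u>0,\ v\in\mathbb{R},\ I\in\mathbb{S}\}$. The slice monogenic Bergman space $\mathcal{B}^2_{\mathrm{slice}}(\mathbb{R}^{n+1}_+)$ is the set of $f\in\mathcal{SM}_l(\mathbb{R}^{n+1}_+)$ with $$\|f\|^2_{\mathcal{B}^2_{\mathrm{slice}}(\mathbb{R}^{n+1}_+)}=\sup_{I\in\mathbb{S}}\int_0^\infty\int_{-\infty}^{\infty}|f(u+Iv)|^2\,dv\,du<\infty.$$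 *)

theory Defs
  imports "HOL-Analysis.Analysis"
begin

section \<open>The real Clifford algebra with n negative generators\<close>

text \<open>
  The generators are indexed by a nonempty finite linearly ordered type, so n is the cardinality of
  that type.  An element \<open>\<Sum>\<^sub>A a\<^sub>A e\<^sub>A\<close> is the vector of its coefficients, indexed by the
  subsets \<open>A\<close> of the index type.  The norm of this vector type is \<open>(\<Sum>\<^sub>A a\<^sub>A\<^sup>2)\<^sup>1\<^sup>/\<^sup>2\<close>.
  The ring operations that the library provides on vectors are componentwise and are not used.
\<close>

type_synonym 'n clifford = "(real, 'n set) vec"

definition blade :: "'n::{finite,linorder} set \<Rightarrow> 'n clifford" where
  "blade A = axis A 1"

abbreviation cliff_one :: "'n::{finite,linorder} clifford" where
  "cliff_one \<equiv> blade {}"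

abbreviation gen :: "'n::{finite,linorder} \<Rightarrow> 'n clifford" where
  "gen i \<equiv> blade {i}"

text \<open>
  Sorting the word \<open>e\<^sub>A e\<^sub>B\<close> costs one sign for each pair \<open>(i, j)\<close> in \<open>A \<times> B\<close> with \<open>j < i\<close>
  (anticommutation), and one more for each \<open>i\<close> in \<open>A \<inter> B\<close> (as \<open>e\<^sub>i e\<^sub>i = -1\<close>).
\<close>

definition blade_sign :: "'n::{finite,linorder} set \<Rightarrow> 'n set \<Rightarrow> real" where
  "blade_sign A B = (\<Prod>i\<in>A. \<Prod>j\<in>B. if j \<le> i then - 1 else 1)"

definition cmult :: "'n::{finite,linorder} clifford \<Rightarrow> 'n clifford \<Rightarrow> 'n clifford"
    (infixl "\<star>" 70) where
  "a \<star> b = (\<Sum>A\<in>UNIV. \<Sum>B\<in>UNIV. (a $ A * b $ B * blade_sign A B) *\<^sub>R blade (sym_diff A B))"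

fun cpow :: "'n::{finite,linorder} clifford \<Rightarrow> nat \<Rightarrow> 'n clifford" where
  "cpow a 0 = cliff_one"
| "cpow a (Suc k) = a \<star> cpow a k"

text \<open>
  The library exponential requires a submultiplicative norm, which the coefficient norm is not.
\<close>

definition cexp :: "'n::{finite,linorder} clifford \<Rightarrow> 'n clifford" where
  "cexp a = (\<Sum>k. (1 / fact k) *\<^sub>R cpow a k)"

subsection \<open>The product is the Clifford product\<close>

lemma clifford_expand: "a = (\<Sum>A\<in>UNIV. (a $ A) *\<^sub>R blade A)"
  by (simp add: vec_eq_iff blade_def axis_def if_distrib cong: if_cong)

lemma bilinear_cmult: "bilinear (\<star>)"
  unfolding bilinear_def
  by (intro conjI allI linearI;
      simp add: cmult_def algebra_simps sum.distrib scaleR_sum_right)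

lemma cmult_sum_left: "sum F S \<star> c = (\<Sum>x\<in>S. F x \<star> c)"
  using bilinear_cmult unfolding bilinear_def by (auto intro: linear_sum)

lemma cmult_sum_right: "c \<star> sum F S = (\<Sum>x\<in>S. c \<star> F x)"
  using bilinear_cmult unfolding bilinear_def by (auto intro: linear_sum)

lemma blade_mult: "blade A \<star> blade B = blade_sign A B *\<^sub>R blade (sym_diff A B)"
proof -
  have "blade A \<star> blade B = (\<Sum>C\<in>UNIV. \<Sum>D\<in>UNIV. if C = A then if D = B
      then blade_sign A B *\<^sub>R blade (sym_diff A B) else 0 else 0)"
    unfolding cmult_def by (intro sum.cong refl) (auto simp: blade_def axis_def)
  also have "\<dots> = (\<Sum>C\<in>UNIV. if C = A
      then (\<Sum>D\<in>UNIV. if D = B then blade_sign A B *\<^sub>R blade (sym_diff A B) else 0) else 0)"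
    by (intro sum.cong refl) simp
  also have "\<dots> = blade_sign A B *\<^sub>R blade (sym_diff A B)" by simp
  finally show ?thesis .
qed

lemma prod_sym_diff:
  fixes h :: "'a::finite \<Rightarrow> real"
  assumes "\<And>x. h x * h x = 1"
  shows "prod h (sym_diff A B) = prod h A * prod h B"
proof -
  have sq: "prod h (A \<inter> B) * prod h (A \<inter> B) = 1"
    using assms by (simp flip: prod.distrib)
  have "prod h A = prod h (A - B) * prod h (A \<inter> B)"
    by (subst prod.union_disjoint [symmetric]) (auto intro: arg_cong [where f = "prod h"])
  moreover have "prod h B = prod h (B - A) * prod h (A \<inter> B)"
    by (subst prod.union_disjoint [symmetric]) (auto intro: arg_cong [where f = "prod h"])
  moreover have "prod h (sym_diff A B) = prod h (A - B) * prod h (B - A)"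
    by (rule prod.union_disjoint) auto
  ultimately show ?thesis using sq by (simp add: algebra_simps)
qed

lemma prod_sq_one:
  fixes h :: "'a \<Rightarrow> real"
  assumes "\<And>x. h x * h x = 1"
  shows "prod h A * prod h A = 1"
  using assms by (simp flip: prod.distrib)

lemma blade_sign_left: "blade_sign (sym_diff A B) C = blade_sign A C * blade_sign B C"
  unfolding blade_sign_def by (intro prod_sym_diff prod_sq_one) simp

lemma blade_sign_right: "blade_sign A (sym_diff B C) = blade_sign A B * blade_sign A C"
  unfolding blade_sign_def prod.distrib [symmetric]
  by (intro prod.cong refl prod_sym_diff) simp

lemma blade_mult_assoc: "blade A \<star> blade B \<star> blade C = blade A \<star> (blade B \<star> blade C)"
proof -
  have "sym_diff (sym_diff A B) C = sym_diff A (sym_diff B C)" by blast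
  then show ?thesis
    by (simp add: blade_mult bilinear_lmul [OF bilinear_cmult] bilinear_rmul [OF bilinear_cmult]
        blade_sign_left blade_sign_right)
qed

lemma cmult_assoc: "a \<star> b \<star> c = a \<star> (b \<star> c)"
proof -
  note b = bilinear_cmult
  have lin1: "linear (\<lambda>x. x \<star> b \<star> c)" "linear (\<lambda>x. x \<star> (b \<star> c))" for b c
    by (auto intro!: linearI simp: bilinear_ladd [OF b] bilinear_lmul [OF b])
  have lin2: "linear (\<lambda>x. a \<star> x \<star> c)" "linear (\<lambda>x. a \<star> (x \<star> c))" for a c
    by (auto intro!: linearI simp: bilinear_ladd [OF b] bilinear_lmul [OF b]
        bilinear_radd [OF b] bilinear_rmul [OF b])
  have lin3: "linear (\<lambda>x. a \<star> b \<star> x)" "linear (\<lambda>x. a \<star> (b \<star> x))" for a b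
    by (auto intro!: linearI simp: bilinear_radd [OF b] bilinear_rmul [OF b])
  have eq_on_blades: "f x = h x" if "linear f" "linear h" "\<And>A. f (blade A) = h (blade A)"
    for f h :: "'a clifford \<Rightarrow> 'a clifford" and x
    by (subst (1 2) clifford_expand [of x])
      (simp add: linear_sum [OF that(1)] linear_sum [OF that(2)]
        linear_scale [OF that(1)] linear_scale [OF that(2)] that(3))
  have "blade A \<star> blade B \<star> c = blade A \<star> (blade B \<star> c)" for A B
    by (rule eq_on_blades [OF lin3 blade_mult_assoc])
  then have "blade A \<star> b \<star> c = blade A \<star> (b \<star> c)" for A
    by (rule eq_on_blades [OF lin2])
  then show ?thesis
    by (rule eq_on_blades [OF lin1])
qed

lemma cliff_one_mult [simp]: "cliff_one \<star> a = a" "a \<star> cliff_one = a"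
proof -
  have "cliff_one \<star> a = (\<Sum>A\<in>UNIV. (a $ A) *\<^sub>R blade A)"
    by (subst clifford_expand [of a])
      (simp add: cmult_sum_right bilinear_rmul [OF bilinear_cmult]
        blade_mult blade_sign_def)
  then show "cliff_one \<star> a = a" by (simp flip: clifford_expand)
  have "a \<star> cliff_one = (\<Sum>A\<in>UNIV. (a $ A) *\<^sub>R blade A)"
    by (subst clifford_expand [of a])
      (simp add: cmult_sum_left bilinear_lmul [OF bilinear_cmult]
        blade_mult blade_sign_def)
  then show "a \<star> cliff_one = a" by (simp flip: clifford_expand)
qed

lemma gen_relation:
  "gen r \<star> gen s + gen s \<star> gen r = (if r = s then (- 2) *\<^sub>R cliff_one else 0)"
proof (cases "r = s")
  case True
  then show ?thesis by (simp add: blade_mult blade_sign_def flip: scaleR_2)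
next
  case False
  then have "{s, r} = {r, s}" "{r} - {s} = {r}" "{s} - {r} = {s}" by auto
  with False show ?thesis by (auto simp: blade_mult blade_sign_def)
qed

lemma blade_ordered_product:
  "blade A = foldr (\<lambda>i a. gen i \<star> a) (sorted_list_of_set A) cliff_one"
proof -
  have "foldr (\<lambda>i a. gen i \<star> a) xs cliff_one = blade (set xs)"
    if "sorted_wrt (<) xs" for xs :: "'a list"
    using that
  proof (induction xs)
    case (Cons x xs)
    then have "sym_diff {x} (set xs) = set (x # xs)" by auto
    moreover have "blade_sign {x} (set xs) = 1"
      using Cons.prems by (auto simp: blade_sign_def intro!: prod.neutral)
    ultimately show ?case using Cons by (simp add: blade_mult)
  qed simp
  from this [of "sorted_list_of_set A"] show ?thesis by simp
qed


section \<open>Paravectors, imaginary units and complex slices\<close>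

text \<open>The space of dimension n + 1 is the linear subspace of paravectors of the algebra.\<close>

definition paravectors :: "'n::{finite,linorder} clifford set" where
  "paravectors = {x0 *\<^sub>R cliff_one + (\<Sum>i\<in>UNIV. x i *\<^sub>R gen i) | x0 x. True}"

definition imag_units :: "'n::{finite,linorder} clifford set" where
  "imag_units = {\<Sum>i\<in>UNIV. x i *\<^sub>R gen i | x. (\<Sum>i\<in>UNIV. (x i)\<^sup>2) = 1}"

definition slice_pt :: "'n::{finite,linorder} clifford \<Rightarrow> real \<Rightarrow> real \<Rightarrow> 'n clifford" where
  "slice_pt I u v = u *\<^sub>R cliff_one + v *\<^sub>R I"

definition half_space :: "'n::{finite,linorder} clifford set" where
  "half_space = {slice_pt I u v | I u v. u > 0 \<and> I \<in> imag_units}"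

lemma imag_unit_square:
  assumes "I \<in> imag_units"
  shows "I \<star> I = - cliff_one"
proof -
  obtain x where I: "I = (\<Sum>i\<in>UNIV. x i *\<^sub>R gen i)" and x: "(\<Sum>i\<in>UNIV. (x i)\<^sup>2) = 1"
    using assms by (auto simp: imag_units_def)
  note b = bilinear_cmult
  have *: "I \<star> I = (\<Sum>i\<in>UNIV. \<Sum>j\<in>UNIV. (x i * x j) *\<^sub>R (gen i \<star> gen j))"
    by (simp add: I cmult_sum_left cmult_sum_right bilinear_lmul [OF b]
        bilinear_rmul [OF b] scaleR_sum_right, rule trans [OF sum.swap], simp add: mult.commute)
  also have "\<dots> = (\<Sum>i\<in>UNIV. \<Sum>j\<in>UNIV. (x i * x j) *\<^sub>R (gen j \<star> gen i))"
    by (rule trans [OF sum.swap]) (simp only: mult.commute)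
  finally have "I \<star> I + I \<star> I
      = (\<Sum>i\<in>UNIV. \<Sum>j\<in>UNIV. (x i * x j) *\<^sub>R (gen i \<star> gen j + gen j \<star> gen i))"
    by (simp add: * scaleR_add_right sum.distrib)
  also have "\<dots> = (\<Sum>i\<in>UNIV. \<Sum>j\<in>UNIV. if i = j then (- 2 * (x i)\<^sup>2) *\<^sub>R cliff_one else 0)"
    by (intro sum.cong refl) (auto simp: gen_relation power2_eq_square)
  also have "\<dots> = (- 2 * (\<Sum>i\<in>UNIV. (x i)\<^sup>2)) *\<^sub>R cliff_one"
    by (simp add: sum_distrib_left scaleR_sum_left flip: sum_negf)
  finally have "2 *\<^sub>R (I \<star> I) = 2 *\<^sub>R (- cliff_one)" by (simp add: x scaleR_2)
  then show ?thesis by (metis scaleR_left_imp_eq zero_neq_numeral)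
qed

lemma cexp_slice_pt:
  assumes "I \<in> imag_units"
  shows "cexp (slice_pt I u v) = exp u *\<^sub>R (cos v *\<^sub>R cliff_one + sin v *\<^sub>R I)"
    and "(\<lambda>k. (1 / fact k) *\<^sub>R cpow (slice_pt I u v) k) sums cexp (slice_pt I u v)"
proof -
  define h where "h z = slice_pt I (Re z) (Im z)" for z
  note b = bilinear_cmult
  have "linear h" by (auto intro!: linearI simp: h_def slice_pt_def algebra_simps)
  then interpret h: bounded_linear h by (rule linear_conv_bounded_linear [THEN iffD1])
  have mult: "h z \<star> h w = h (z * w)" for z w
    by (simp add: h_def slice_pt_def bilinear_ladd [OF b] bilinear_radd [OF b]
        bilinear_lmul [OF b] bilinear_rmul [OF b] imag_unit_square [OF assms] algebra_simps)
  have pow: "cpow (h z) k = h (z ^ k)" for z k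
    by (induction k) (simp_all add: mult, simp add: h_def slice_pt_def)
  have "(\<lambda>k. (1 / fact k) *\<^sub>R cpow (h z) k) sums h (exp z)" for z
    using h.sums [OF exp_converges [of z]] by (simp add: pow h.scaleR divide_inverse)
  from this [of "Complex u v"]
  have *: "(\<lambda>k. (1 / fact k) *\<^sub>R cpow (slice_pt I u v) k) sums h (exp (Complex u v))"
    by (simp add: h_def)
  then show "cexp (slice_pt I u v) = exp u *\<^sub>R (cos v *\<^sub>R cliff_one + sin v *\<^sub>R I)"
    by (simp add: cexp_def sums_iff h_def Re_exp Im_exp slice_pt_def algebra_simps)
  from * show "(\<lambda>k. (1 / fact k) *\<^sub>R cpow (slice_pt I u v) k) sums cexp (slice_pt I u v)"
    by (simp add: cexp_def sums_iff)
qed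

lemma half_space_eq: "half_space = {x \<in> paravectors. x $ {} > 0}"
proof -
  have comp: "(x0 *\<^sub>R cliff_one + (\<Sum>i\<in>UNIV. y i *\<^sub>R gen i)) $ {} = x0"
    for x0 and y :: "'a \<Rightarrow> real"
    by (simp add: blade_def axis_def)
  have "slice_pt I u v \<in> paravectors \<and> slice_pt I u v $ {} = u"
    if I_unit: "I \<in> imag_units" for I :: "'a clifford" and u v
  proof -
    obtain x where I: "I = (\<Sum>i\<in>UNIV. x i *\<^sub>R gen i)"
      using I_unit by (auto simp: imag_units_def)
    have "slice_pt I u v = u *\<^sub>R cliff_one + (\<Sum>i\<in>UNIV. (v * x i) *\<^sub>R gen i)"
      by (simp add: slice_pt_def I scaleR_sum_right)
    with comp [of u "\<lambda>i. v * x i"] show ?thesis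
      unfolding paravectors_def by auto
  qed
  moreover have "x0 *\<^sub>R cliff_one + (\<Sum>i\<in>UNIV. y i *\<^sub>R gen i) \<in> half_space" if "x0 > 0"
    for x0 and y :: "'a \<Rightarrow> real"
  proof -
    define r where "r = sqrt (\<Sum>i\<in>UNIV. (y i)\<^sup>2)"
    have "\<exists>z. (\<Sum>i\<in>UNIV. (z i)\<^sup>2) = 1 \<and> (\<forall>i. y i = r * z i)"
    proof (cases "r = 0")
      case True
      then have "y i = 0" for i
        by (simp add: r_def sum_nonneg_eq_0_iff)
      moreover have "(\<Sum>i\<in>UNIV. (if i = (undefined :: 'a) then 1 else 0 :: real)\<^sup>2) = 1"
        by (simp add: if_distrib [of "\<lambda>t. t\<^sup>2"] cong: if_cong)
      ultimately show ?thesis using True by (metis mult_zero_left)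
    next
      case False
      have "(\<Sum>i\<in>UNIV. (y i / r)\<^sup>2) = (\<Sum>i\<in>UNIV. (y i)\<^sup>2) / r\<^sup>2"
        by (simp add: power_divide sum_divide_distrib)
      also have "\<dots> = 1" using False by (simp add: r_def sum_nonneg)
      finally show ?thesis using False by (intro exI [of _ "\<lambda>i. y i / r"]) simp
    qed
    then obtain z where z: "(\<Sum>i\<in>UNIV. (z i)\<^sup>2) = 1" "\<And>i. y i = r * z i" by blast
    have "x0 *\<^sub>R cliff_one + (\<Sum>i\<in>UNIV. y i *\<^sub>R gen i) = slice_pt (\<Sum>i\<in>UNIV. z i *\<^sub>R gen i) x0 r"
      by (simp add: slice_pt_def z(2) scaleR_sum_right)
    moreover have "(\<Sum>i\<in>UNIV. z i *\<^sub>R gen i) \<in> imag_units"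
      using z(1) by (auto simp: imag_units_def)
    ultimately show ?thesis using that unfolding half_space_def by blast
  qed
  ultimately show ?thesis
    using comp by (auto simp: half_space_def paravectors_def)
qed

lemma half_space_open: "openin (top_of_set paravectors) half_space"
proof -
  have "open {x :: 'a clifford. x $ {} > 0}"
    by (intro open_Collect_less continuous_intros)
  moreover have "half_space = paravectors \<inter> {x :: 'a clifford. x $ {} > 0}"
    by (auto simp: half_space_eq)
  ultimately show ?thesis by (metis openin_open_Int)
qed


section \<open>Slice monogenic functions and the slice Bergman space\<close>

definition slice_dbar ::
    "'n::{finite,linorder} clifford \<Rightarrow> ('n clifford \<Rightarrow> 'n clifford) \<Rightarrow> real \<Rightarrow> real \<Rightarrow> 'n clifford" where
  "slice_dbar I f u v = (1 / 2) *\<^sub>R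
     (vector_derivative (\<lambda>s. f (slice_pt I s v)) (at u)
      + I \<star> vector_derivative (\<lambda>t. f (slice_pt I u t)) (at v))"

text \<open>
  \<open>U\<close> is meant to be relatively open in the space of paravectors.  Functions on \<open>U\<close> are total
  functions whose values outside \<open>U\<close> are irrelevant; differentiability on \<open>U\<close> is within \<open>U\<close>, so
  only increments in paravector directions count.
\<close>

definition slice_monogenic ::
    "'n::{finite,linorder} clifford set \<Rightarrow> ('n clifford \<Rightarrow> 'n clifford) set" where
  "slice_monogenic U = {f. f differentiable_on U \<and>
     (\<forall>I\<in>imag_units. \<forall>u v. slice_pt I u v \<in> U \<longrightarrow> slice_dbar I f u v = 0)}"

definition bergman_norm_sq :: "('n::{finite,linorder} clifford \<Rightarrow> 'n clifford) \<Rightarrow> ennreal" where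
  "bergman_norm_sq f = (SUP I\<in>imag_units.
     \<integral>\<^sup>+u\<in>{0<..}. (\<integral>\<^sup>+v. ennreal ((norm (f (slice_pt I u v)))\<^sup>2) \<partial>lebesgue) \<partial>lebesgue)"

definition slice_bergman_space :: "('n::{finite,linorder} clifford \<Rightarrow> 'n clifford) set" where
  "slice_bergman_space = {f \<in> slice_monogenic half_space. bergman_norm_sq f < \<infinity>}"


section \<open>The weighted Lebesgue space on the negative half-line\<close>

definition weighted_norm_sq :: "(real \<Rightarrow> 'n::{finite,linorder} clifford) \<Rightarrow> ennreal" where
  "weighted_norm_sq g = (\<integral>\<^sup>+w\<in>{..<0}. ennreal ((norm (g w))\<^sup>2 / (- w)) \<partial>lebesgue)"

definition weighted_L2 :: "(real \<Rightarrow> 'n::{finite,linorder} clifford) set" where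
  "weighted_L2 = {g. set_borel_measurable lebesgue {..<0} g \<and> weighted_norm_sq g < \<infinity>}"

end

theory Submission
  imports Defs
    "HOL-Probability.Characteristic_Functions"
    "HOL-Complex_Analysis.Conformal_Mappings"
begin

text \<open>
  On a single slice, with \<open>I\<close> playing the role of the imaginary unit, the hypothesis says that
  \<open>v \<mapsto> f (u + I v)\<close> is, up to the factor \<open>1 / sqrt (2 pi)\<close>, the Fourier transform of
  \<open>w \<mapsto> exp (u w) g\<^sub>I w\<close> on the negative half-line.  Plancherel turns the integral over \<open>v\<close> into
  \<open>\<integral> exp (2 u w) |g\<^sub>I w|\<^sup>2 dw\<close>, and integrating over \<open>u > 0\<close> replaces \<open>exp (2 u w)\<close> by
  \<open>1 / (- 2 w)\<close>; this is the weight and the constant of the claim.  The form of Plancherel used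
  here is the upper bound for the transform of an integrable function; it follows by damping with
  Gaussians, whose Fourier transforms are again Gaussians (\<open>plancherel_inequality\<close>).

  Two points go beyond this computation.  The norm is a supremum over all slices whereas the bound
  involves one \<open>g\<^sub>I\<close>, so the densities belonging to different slices have to be compared.  For each
  coefficient index \<open>A\<close> let \<open>H\<^sub>A z = \<integral> exp (z w) (g\<^sub>I w)\<^sub>A dw / sqrt (2 pi)\<close>, an ordinary complex
  Laplace transform, holomorphic on the right half-plane (\<open>laplace_holomorphic\<close>).  All slices
  contain the positive real axis, where \<open>f\<close> determines every \<open>H\<^sub>A\<close>; by the identity theorem the
  \<open>H\<^sub>A\<close> do not depend on \<open>I\<close> (\<open>laplace_eq_of_eq_on_reals\<close>).  Hence
  \<open>f (u + I v) = \<Sum>\<^sub>A (Re H\<^sub>A + I Im H\<^sub>A) e\<^sub>A\<close> at \<open>u + \<i> v\<close> for all \<open>I\<close> at once: \<open>f\<close> is the slice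
  function induced by the holomorphic stem function \<open>(H\<^sub>A)\<^sub>A\<close>.

  The second point is that such an \<open>f\<close> is slice monogenic.  The Cauchy-Riemann equation on a slice
  is the complex linearity of the derivative of \<open>H\<close>.  Real differentiability in all paravector
  directions is clear away from the real axis, and at a real point it holds because there the stem
  function and its derivative are real, so that the first order term \<open>(x - u) H' u\<close> no longer
  involves \<open>I\<close> (\<open>stem_function.slice_monogenic\<close>).

  The norm on a slice is also read off from the stem function.  Left multiplication by \<open>I\<close> is
  orthogonal, so averaging over \<open>v\<close> and \<open>- v\<close> and applying the parallelogram law gives
  \<open>\<integral> |f (u + I v)|\<^sup>2 dv = \<Sum>\<^sub>A \<integral> |H\<^sub>A (u + \<i> v)|\<^sup>2 dv\<close> (\<open>stem_function.slice_L2_norm\<close>), which is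
  the same for every \<open>I\<close> and reduces the estimate to scalar functions
  (\<open>laplace_bergman_bound\<close>).
\<close>

text \<open>Only the Clifford product uses the infix star below.\<close>

no_notation convolution (infix \<open>\<star>\<close> 50)


section \<open>The Plancherel inequality for integrable functions\<close>

text \<open>
  This is the characteristic function of the standard normal distribution, rescaled.  The right-hand
  side is a density of total mass one up to its factor, which is what makes the constant in
  Plancherel come out independent of \<open>s\<close>.
\<close>

lemma cosine_transform_gaussian:
  assumes "s > 0"
  shows "(\<integral>v. std_normal_density (v / s) * cos (v * t) \<partial>lborel) =
    sqrt (2 * pi) * normal_density 0 (1 / s) t"
proof -
  interpret real_distribution std_normal_distribution by (rule real_dist_normal_dist)
  have "(\<integral>x. cos (s * t * x) \<partial>std_normal_distribution) = Re (char std_normal_distribution (s * t))"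
    unfolding char_def by (subst integral_Re [symmetric]) (auto simp: Re_exp intro!: integrable_iexp)
  also have "\<dots> = exp (- ((s * t)\<^sup>2) / 2)"
    unfolding char_std_normal_distribution by (simp only: Re_complex_of_real)
  finally have "(\<integral>x. std_normal_density x * cos (s * t * x) \<partial>lborel) = exp (- ((s * t)\<^sup>2) / 2)"
    by (subst (asm) integral_density) auto
  moreover have "(\<integral>v. std_normal_density (v / s) * cos (v * t) \<partial>lborel)
      = s * (\<integral>x. std_normal_density x * cos (s * t * x) \<partial>lborel)"
    using assms by (subst lborel_integral_real_affine [where c = s and t = 0]) (auto simp: mult_ac)
  moreover have "sqrt (2 * pi) * normal_density 0 (1 / s) t = s * exp (- ((s * t)\<^sup>2) / 2)"
    using assms
    by (simp add: normal_density_def real_sqrt_divide real_sqrt_mult field_simps)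
  ultimately show ?thesis by simp
qed

lemma integrable_product_pair:
  fixes f g :: "real \<Rightarrow> real"
  assumes f: "integrable lborel f" and g: "integrable lborel g"
  shows "integrable (lborel \<Otimes>\<^sub>M lborel) (\<lambda>(x, y). f x * g y)"
proof -
  have [measurable]: "f \<in> borel_measurable borel" "g \<in> borel_measurable borel"
    using f g by auto
  show ?thesis
    by (intro lborel_pair.Fubini_integrable)
      (auto simp: abs_mult intro!: integrable_mult_left integrable_mult_right f g)
qed

text \<open>
  The left-hand side is the squared modulus of the Fourier transform of \<open>h\<close> at \<open>v\<close>.  The real
  form avoids complex conjugates: the addition theorem for the cosine merges the two squares.
\<close>

lemma fourier_square_as_double_integral:
  fixes h :: "real \<Rightarrow> real"
  assumes h: "integrable lborel h"
  shows "(\<integral>w. cos (v * w) * h w \<partial>lborel)\<^sup>2 + (\<integral>w. sin (v * w) * h w \<partial>lborel)\<^sup>2 =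
    (\<integral>(x, y). cos (v * (x - y)) * (h x * h y) \<partial>(lborel \<Otimes>\<^sub>M lborel))"
proof -
  have [measurable]: "h \<in> borel_measurable borel" using h by auto
  have sq: "integrable (lborel \<Otimes>\<^sub>M lborel) (\<lambda>(x, y). c x * h x * (c y * h y))"
      "(\<integral>w. c w * h w \<partial>lborel)\<^sup>2 = (\<integral>(x, y). c x * h x * (c y * h y) \<partial>(lborel \<Otimes>\<^sub>M lborel))"
    if [measurable]: "c \<in> borel_measurable borel" and "\<And>x. \<bar>c x\<bar> \<le> 1" for c :: "real \<Rightarrow> real"
  proof -
    have c: "integrable lborel (\<lambda>w. c w * h w)"
      using that by (intro Bochner_Integration.integrable_bound [OF h])
        (auto simp: abs_mult intro!: mult_left_le_one_le)
    show i: "integrable (lborel \<Otimes>\<^sub>M lborel) (\<lambda>(x, y). c x * h x * (c y * h y))"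
      by (rule integrable_product_pair [OF c c])
    show "(\<integral>w. c w * h w \<partial>lborel)\<^sup>2 =
        (\<integral>(x, y). c x * h x * (c y * h y) \<partial>(lborel \<Otimes>\<^sub>M lborel))"
      by (subst lborel_pair.integral_fst [OF i, symmetric]) (simp add: power2_eq_square)
  qed
  have "cos (v * (x - y)) * (h x * h y) = cos (v * x) * h x * (cos (v * y) * h y)
      + sin (v * x) * h x * (sin (v * y) * h y)" for x y
    by (simp add: right_diff_distrib cos_diff algebra_simps)
  then have "(\<integral>(x, y). cos (v * (x - y)) * (h x * h y) \<partial>(lborel \<Otimes>\<^sub>M lborel)) =
     (\<integral>(x, y). cos (v * x) * h x * (cos (v * y) * h y) \<partial>(lborel \<Otimes>\<^sub>M lborel)) +
     (\<integral>(x, y). sin (v * x) * h x * (sin (v * y) * h y) \<partial>(lborel \<Otimes>\<^sub>M lborel))"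
    using sq(1) [of "\<lambda>w. cos (v * w)"] sq(1) [of "\<lambda>w. sin (v * w)"]
    by (subst Bochner_Integration.integral_add [symmetric]) (auto simp: case_prod_unfold)
  then show ?thesis by (simp add: sq(2))
qed

text \<open>
  With the Gaussian weight everything is absolutely integrable, so Fubini applies and the integral
  over \<open>v\<close> produces the kernel \<open>k (x - y)\<close> with \<open>k\<close> a probability density.  Then
  \<open>h x h y \<le> (h x\<^sup>2 + h y\<^sup>2) / 2\<close>, and integrating out the variable that occurs only in \<open>k\<close>
  leaves \<open>\<integral> h\<^sup>2\<close>.
\<close>

lemma gaussian_weighted_plancherel:
  fixes h :: "real \<Rightarrow> real"
  assumes h: "integrable lborel h" and "s > 0"
  shows "(\<integral>\<^sup>+v. ennreal (std_normal_density (v / s) *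
      ((\<integral>w. cos (v * w) * h w \<partial>lborel)\<^sup>2 + (\<integral>w. sin (v * w) * h w \<partial>lborel)\<^sup>2)) \<partial>lborel)
    \<le> ennreal (sqrt (2 * pi)) * (\<integral>\<^sup>+w. ennreal ((h w)\<^sup>2) \<partial>lborel)"
proof -
  have [measurable]: "h \<in> borel_measurable borel" using h by auto
  let ?P = "lborel \<Otimes>\<^sub>M lborel :: (real \<times> real) measure"
  let ?F = "\<lambda>v. (\<integral>w. cos (v * w) * h w \<partial>lborel)\<^sup>2 + (\<integral>w. sin (v * w) * h w \<partial>lborel)\<^sup>2"
  let ?k = "normal_density 0 (1 / s)"
  interpret Q: pair_sigma_finite lborel ?P ..
  have K: "integrable lborel (\<lambda>v. std_normal_density (v / s))"
    using lborel_integrable_real_affine [of std_normal_density "1 / s" 0] \<open>s > 0\<close>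
    by (simp add: integrable_normal_density)
  have E: "ennreal (sqrt (2 * pi) / 2 * ((h a)\<^sup>2 * ?k t)) =
      ennreal (sqrt (2 * pi) / 2) * (ennreal ((h a)\<^sup>2) * ennreal (?k t))" for a t
    by (simp only: ennreal_mult mult_nonneg_nonneg zero_le_power2 normal_density_nonneg
        real_sqrt_ge_zero zero_le_divide_iff pi_ge_zero zero_le_numeral simp_thms)
  have int_h: "integrable ?P (\<lambda>(x, y). h x * h y)"
    by (rule integrable_product_pair [OF h h])
  have big: "integrable (lborel \<Otimes>\<^sub>M ?P)
      (\<lambda>(v, p). std_normal_density (v / s) * (cos (v * (fst p - snd p)) * (h (fst p) * h (snd p))))"
  proof (rule Bochner_Integration.integrable_bound)
    show "integrable (lborel \<Otimes>\<^sub>M ?P) (\<lambda>(v, p). std_normal_density (v / s) * (h (fst p) * h (snd p)))"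
      using int_h [unfolded case_prod_unfold] K
      by (intro Q.Fubini_integrable)
        (auto simp: abs_mult case_prod_unfold intro!: integrable_mult_left integrable_mult_right)
    show "AE x in lborel \<Otimes>\<^sub>M ?P. norm (case x of (v, p) \<Rightarrow>
         std_normal_density (v / s) * (cos (v * (fst p - snd p)) * (h (fst p) * h (snd p))))
      \<le> norm (case x of (v, p) \<Rightarrow> std_normal_density (v / s) * (h (fst p) * h (snd p)))"
      by (intro AE_I2) (auto simp: abs_mult intro!: mult_left_mono mult_left_le_one_le)
  qed measurable
  have F: "?F v * std_normal_density (v / s) = (\<integral>p. std_normal_density (v / s) *
      (cos (v * (fst p - snd p)) * (h (fst p) * h (snd p))) \<partial>?P)" for v
    by (simp add: fourier_square_as_double_integral [OF h] case_prod_unfold)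
  have "integrable lborel (\<lambda>v. std_normal_density (v / s) * ?F v)"
    using Q.integrable_fst [OF big] by (simp only: mult.commute [of "std_normal_density _" "_ + _"] F)
  then have "(\<integral>\<^sup>+v. ennreal (std_normal_density (v / s) * ?F v) \<partial>lborel)
      = ennreal (\<integral>v. std_normal_density (v / s) * ?F v \<partial>lborel)"
    by (rule nn_integral_eq_integral) simp
  also have "(\<integral>v. std_normal_density (v / s) * ?F v \<partial>lborel) =
      (\<integral>p. (\<integral>v. std_normal_density (v / s) * (cos (v * (fst p - snd p)) * (h (fst p) * h (snd p))) \<partial>lborel) \<partial>?P)"
    by (simp only: mult.commute [of "std_normal_density _" "_ + _"] F Q.Fubini_integral [OF big])
  also have "\<dots> = (\<integral>p. (h (fst p) * h (snd p)) * (\<integral>v. std_normal_density (v / s) * cos (v * (fst p - snd p)) \<partial>lborel) \<partial>?P)"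
    by (subst integral_mult_right_zero [symmetric]) (simp add: mult_ac)
  also have "\<dots> = (\<integral>p. (h (fst p) * h (snd p)) * (sqrt (2 * pi) * ?k (fst p - snd p)) \<partial>?P)"
    using \<open>s > 0\<close> by (simp only: cosine_transform_gaussian)
  also have "ennreal \<dots> \<le> (\<integral>\<^sup>+p. ennreal (norm ((h (fst p) * h (snd p)) * (sqrt (2 * pi) * ?k (fst p - snd p)))) \<partial>?P)"
    (is "ennreal (integral\<^sup>L _ ?g) \<le> _")
  proof (cases "integrable ?P ?g")
    case True
    have "ennreal (integral\<^sup>L ?P ?g) \<le> ennreal (norm (integral\<^sup>L ?P ?g))"
      by (intro ennreal_leI) simp
    also note integral_norm_bound_ennreal [OF True]
    finally show ?thesis .
  qed (simp add: not_integrable_integral_eq)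
  also have "\<dots> \<le> (\<integral>\<^sup>+p. ennreal (sqrt (2 * pi) / 2 * ((h (fst p))\<^sup>2 * ?k (fst p - snd p)))
      + ennreal (sqrt (2 * pi) / 2 * ((h (snd p))\<^sup>2 * ?k (fst p - snd p))) \<partial>?P)"
  proof (intro nn_integral_mono)
    fix p :: "real \<times> real"
    have "\<bar>h (fst p) * h (snd p)\<bar> \<le> ((h (fst p))\<^sup>2 + (h (snd p))\<^sup>2) / 2"
      using sum_squares_bound [of "\<bar>h (fst p)\<bar>" "\<bar>h (snd p)\<bar>"] by (simp add: abs_mult)
    then have "\<bar>h (fst p) * h (snd p)\<bar> * (sqrt (2 * pi) * ?k (fst p - snd p))
        \<le> ((h (fst p))\<^sup>2 + (h (snd p))\<^sup>2) / 2 * (sqrt (2 * pi) * ?k (fst p - snd p))"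
      by (intro mult_right_mono) auto
    then have "ennreal (norm ((h (fst p) * h (snd p)) * (sqrt (2 * pi) * ?k (fst p - snd p)))) \<le>
        ennreal (sqrt (2 * pi) / 2 * ((h (fst p))\<^sup>2 * ?k (fst p - snd p)) +
          sqrt (2 * pi) / 2 * ((h (snd p))\<^sup>2 * ?k (fst p - snd p)))"
      by (intro ennreal_leI) (simp add: abs_mult algebra_simps)
    then show "ennreal (norm ((h (fst p) * h (snd p)) * (sqrt (2 * pi) * ?k (fst p - snd p)))) \<le>
        ennreal (sqrt (2 * pi) / 2 * ((h (fst p))\<^sup>2 * ?k (fst p - snd p)))
      + ennreal (sqrt (2 * pi) / 2 * ((h (snd p))\<^sup>2 * ?k (fst p - snd p)))"
      by (subst ennreal_plus [symmetric]) (simp_all only: zero_le_mult_iff, auto)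
  qed
  also have "\<dots> = (\<integral>\<^sup>+p. ennreal (sqrt (2 * pi) / 2 * ((h (fst p))\<^sup>2 * ?k (fst p - snd p))) \<partial>?P)
      + (\<integral>\<^sup>+p. ennreal (sqrt (2 * pi) / 2 * ((h (snd p))\<^sup>2 * ?k (fst p - snd p))) \<partial>?P)"
    by (rule nn_integral_add) measurable
  also have "(\<integral>\<^sup>+p. ennreal (sqrt (2 * pi) / 2 * ((h (fst p))\<^sup>2 * ?k (fst p - snd p))) \<partial>?P)
      = ennreal (sqrt (2 * pi) / 2) * (\<integral>\<^sup>+w. ennreal ((h w)\<^sup>2) \<partial>lborel)"
  proof -
    have "(\<integral>\<^sup>+y. ennreal (?k (x - y)) \<partial>lborel) = 1" for x
    proof -
      have "(\<integral>\<^sup>+y. ennreal (?k (x - y)) \<partial>lborel) = (\<integral>\<^sup>+y. ennreal (normal_density x (1 / s) y) \<partial>lborel)"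
        by (intro nn_integral_cong) (simp add: normal_density_def power2_commute)
      then show ?thesis using \<open>s > 0\<close> by (simp add: nn_integral_eq_integral)
    qed
    then show ?thesis
      by (subst lborel.nn_integral_fst [symmetric])
        (measurable, simp add: E nn_integral_cmult del: times_divide_eq_left)
  qed
  also have "(\<integral>\<^sup>+p. ennreal (sqrt (2 * pi) / 2 * ((h (snd p))\<^sup>2 * ?k (fst p - snd p))) \<partial>?P)
      = ennreal (sqrt (2 * pi) / 2) * (\<integral>\<^sup>+w. ennreal ((h w)\<^sup>2) \<partial>lborel)"
  proof -
    have "(\<integral>\<^sup>+x. ennreal (?k (x - y)) \<partial>lborel) = 1" for y
    proof -
      have "(\<integral>\<^sup>+x. ennreal (?k (x - y)) \<partial>lborel) = (\<integral>\<^sup>+x. ennreal (normal_density y (1 / s) x) \<partial>lborel)"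
        by (intro nn_integral_cong) (simp add: normal_density_def)
      then show ?thesis using \<open>s > 0\<close> by (simp add: nn_integral_eq_integral)
    qed
    then show ?thesis
      by (subst lborel_pair.nn_integral_snd [symmetric])
        (measurable, simp add: E nn_integral_cmult del: times_divide_eq_left)
  qed
  also have "ennreal (sqrt (2 * pi) / 2) * (\<integral>\<^sup>+w. ennreal ((h w)\<^sup>2) \<partial>lborel) +
      ennreal (sqrt (2 * pi) / 2) * (\<integral>\<^sup>+w. ennreal ((h w)\<^sup>2) \<partial>lborel)
      = ennreal (sqrt (2 * pi)) * (\<integral>\<^sup>+w. ennreal ((h w)\<^sup>2) \<partial>lborel)"
    by (simp add: distrib_right [symmetric] flip: ennreal_plus)
  finally show ?thesis .
qed

text \<open>
  Let the Gaussians widen to the constant \<open>1 / sqrt (2 pi)\<close>; Fatou suffices for the inequality.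
  The right-hand side may be infinite.
\<close>

theorem plancherel_inequality:
  fixes h :: "real \<Rightarrow> real"
  assumes h: "integrable lborel h"
  shows "(\<integral>\<^sup>+v. ennreal
      ((\<integral>w. cos (v * w) * h w \<partial>lborel)\<^sup>2 + (\<integral>w. sin (v * w) * h w \<partial>lborel)\<^sup>2) \<partial>lborel)
    \<le> ennreal (2 * pi) * (\<integral>\<^sup>+w. ennreal ((h w)\<^sup>2) \<partial>lborel)"
proof -
  have [measurable]: "h \<in> borel_measurable borel" using h by auto
  let ?F = "\<lambda>v. (\<integral>w. cos (v * w) * h w \<partial>lborel)\<^sup>2 + (\<integral>w. sin (v * w) * h w \<partial>lborel)\<^sup>2"
  let ?G = "\<lambda>n v. ennreal (std_normal_density (v / real (Suc n)) * ?F v)"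
  let ?R = "\<integral>\<^sup>+w. ennreal ((h w)\<^sup>2) \<partial>lborel"
  have lim: "(\<lambda>n. ?G n v) \<longlonglongrightarrow> ennreal (1 / sqrt (2 * pi) * ?F v)" for v
  proof (intro tendsto_ennrealI tendsto_mult_right)
    have "(\<lambda>n. std_normal_density (v / real (Suc n))) \<longlonglongrightarrow> std_normal_density 0"
    proof (rule isCont_tendsto_compose [where g = std_normal_density])
      show "isCont std_normal_density 0"
        unfolding normal_density_def by (intro continuous_intros) auto
      show "(\<lambda>n. v / real (Suc n)) \<longlonglongrightarrow> 0"
        by (rule LIMSEQ_Suc [OF lim_const_over_n])
    qed
    then show "(\<lambda>n. std_normal_density (v / real (Suc n))) \<longlonglongrightarrow> 1 / sqrt (2 * pi)"
      by (simp add: normal_density_def)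
  qed
  have "ennreal (1 / sqrt (2 * pi)) * (\<integral>\<^sup>+v. ennreal (?F v) \<partial>lborel)
      = (\<integral>\<^sup>+v. ennreal (1 / sqrt (2 * pi) * ?F v) \<partial>lborel)"
    by (subst nn_integral_cmult [symmetric])
      (measurable, intro nn_integral_cong ennreal_mult [symmetric], auto)
  also have "\<dots> = (\<integral>\<^sup>+v. liminf (\<lambda>n. ?G n v) \<partial>lborel)"
    by (intro nn_integral_cong lim_imp_Liminf [symmetric] lim) auto
  also have "\<dots> \<le> liminf (\<lambda>n. \<integral>\<^sup>+v. ?G n v \<partial>lborel)"
    by (rule nn_integral_liminf) measurable
  also have "\<dots> \<le> ennreal (sqrt (2 * pi)) * ?R"
    using gaussian_weighted_plancherel [OF h]
    by (intro order_trans [OF Liminf_le] always_eventually) auto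
  finally have "ennreal (sqrt (2 * pi)) * (ennreal (1 / sqrt (2 * pi)) * (\<integral>\<^sup>+v. ennreal (?F v) \<partial>lborel))
      \<le> ennreal (sqrt (2 * pi)) * (ennreal (sqrt (2 * pi)) * ?R)"
    by (rule mult_left_mono) simp
  then show ?thesis
    by (simp add: mult.assoc [symmetric] flip: ennreal_mult)
qed


section \<open>Laplace transforms of densities on the negative half-line\<close>

definition laplace :: "(real \<Rightarrow> real) \<Rightarrow> complex \<Rightarrow> complex" where
  "laplace p z = (\<integral>w. exp (z * of_real w) * of_real (p w) \<partial>lborel)"

text \<open>
  A function on the negative half-line is extended by zero, so that all integrals run over the whole
  line.  The integrability condition is exactly absolute convergence of the Laplace integral on
  the right half-plane.
\<close>

definition laplace_density :: "(real \<Rightarrow> real) \<Rightarrow> bool" where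
  "laplace_density p \<longleftrightarrow> (\<forall>w\<ge>0. p w = 0) \<and> (\<forall>a>0. integrable lborel (\<lambda>w. exp (a * w) * p w))"

lemma laplace_density_measurable:
  assumes "laplace_density p"
  shows "p \<in> borel_measurable borel"
proof -
  have "integrable lborel (\<lambda>w. exp (1 * w) * p w)"
    using assms unfolding laplace_density_def by (metis zero_less_one)
  then have [measurable]: "(\<lambda>w. exp w * p w) \<in> borel_measurable borel"
    by (auto dest: borel_measurable_integrable)
  have "(\<lambda>w. exp (- w) * (exp w * p w)) \<in> borel_measurable borel"
    by measurable
  then show ?thesis by (simp add: mult.assoc [symmetric] flip: exp_add)
qed

lemma power_over_fact_le_exp:
  fixes x :: real
  assumes "x \<ge> 0"
  shows "x ^ k / fact k \<le> exp x"
proof -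
  have "(\<Sum>n\<in>{k}. x ^ n /\<^sub>R fact n) \<le> (\<Sum>n. x ^ n /\<^sub>R fact n)"
    using assms by (intro sum_le_suminf summable_exp_generic) auto
  also have "\<dots> = exp x"
    by (simp only: exp_def)
  finally show ?thesis by (simp add: divide_inverse mult.commute)
qed

text \<open>
  Differentiating under the integral costs factors \<open>w\<close>; half of the exponential pays for them, as
  \<open>|w|\<^sup>k \<le> k! (2 / a)\<^sup>k exp (a |w| / 2)\<close>.
\<close>

lemma laplace_density_moment:
  assumes p: "laplace_density p" and "a > 0"
  shows "integrable lborel (\<lambda>w. \<bar>w\<bar> ^ k * (exp (a * w) * \<bar>p w\<bar>))"
proof (rule Bochner_Integration.integrable_bound)
  note [measurable] = laplace_density_measurable [OF p]
  have "integrable lborel (\<lambda>w. exp (a / 2 * w) * p w)"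
    using p \<open>a > 0\<close> unfolding laplace_density_def by (metis half_gt_zero)
  from integrable_norm [OF this]
  show "integrable lborel (\<lambda>w. fact k / (a / 2) ^ k * (exp (a / 2 * w) * \<bar>p w\<bar>))"
    by (intro integrable_mult_right) (simp add: abs_mult)
  have "\<bar>w\<bar> ^ k * (exp (a * w) * \<bar>p w\<bar>) \<le> fact k / (a / 2) ^ k * (exp (a / 2 * w) * \<bar>p w\<bar>)" for w
  proof (cases "w < 0")
    case True
    have "(a / 2 * \<bar>w\<bar>) ^ k / fact k \<le> exp (a / 2 * \<bar>w\<bar>)"
      using \<open>a > 0\<close> by (intro power_over_fact_le_exp) simp
    then have "\<bar>w\<bar> ^ k \<le> fact k / (a / 2) ^ k * exp (a / 2 * \<bar>w\<bar>)"
      using \<open>a > 0\<close> by (simp add: field_simps power_mult_distrib)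
    then have "\<bar>w\<bar> ^ k * (exp (a * w) * \<bar>p w\<bar>)
        \<le> fact k / (a / 2) ^ k * exp (a / 2 * \<bar>w\<bar>) * (exp (a * w) * \<bar>p w\<bar>)"
      by (intro mult_right_mono) auto
    also have "\<dots> = fact k / (a / 2) ^ k * (exp (a / 2 * \<bar>w\<bar> + a * w) * \<bar>p w\<bar>)"
      by (simp add: exp_add mult_ac)
    also have "a / 2 * \<bar>w\<bar> + a * w = a / 2 * w"
      using True by simp
    finally show ?thesis .
  next
    case False
    then show ?thesis using p by (simp add: laplace_density_def)
  qed
  then show "AE w in lborel. norm (\<bar>w\<bar> ^ k * (exp (a * w) * \<bar>p w\<bar>))
      \<le> norm (fact k / (a / 2) ^ k * (exp (a / 2 * w) * \<bar>p w\<bar>))"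
    using \<open>a > 0\<close> by (intro AE_I2) (simp add: abs_mult)
  show "(\<lambda>w. \<bar>w\<bar> ^ k * (exp (a * w) * \<bar>p w\<bar>)) \<in> borel_measurable lborel"
    by measurable
qed

lemma integrable_laplace_moment:
  assumes p: "laplace_density p" and "Re z > 0"
  shows "integrable lborel (\<lambda>w. of_real w ^ k * (exp (z * of_real w) * of_real (p w)))"
proof (rule Bochner_Integration.integrable_bound)
  note [measurable] = laplace_density_measurable [OF p]
  show "integrable lborel (\<lambda>w. \<bar>w\<bar> ^ k * (exp (Re z * w) * \<bar>p w\<bar>))"
    using assms by (rule laplace_density_moment)
  show "AE w in lborel. norm (complex_of_real w ^ k * (exp (z * of_real w) * of_real (p w)))
      \<le> norm (\<bar>w\<bar> ^ k * (exp (Re z * w) * \<bar>p w\<bar>))"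
    by (intro AE_I2) (simp add: norm_mult norm_power abs_mult)
  show "(\<lambda>w. complex_of_real w ^ k * (exp (z * of_real w) * of_real (p w)))
      \<in> borel_measurable lborel"
    by measurable
qed

text \<open>
  The second order Taylor bound for \<open>exp\<close> gives an error that is quadratic in the increment.  As long
  as the increment is at most \<open>Re z / 2\<close>, the factor \<open>exp (- (Re z / 2) w)\<close> that it introduces
  leaves the integrand decaying like \<open>exp ((Re z / 2) w)\<close>, uniformly.
\<close>

lemma has_field_derivative_laplace:
  assumes p: "laplace_density p" and z: "Re z > 0"
  shows "(laplace p has_field_derivative
    (\<integral>w. of_real w * (exp (z * of_real w) * of_real (p w)) \<partial>lborel)) (at z)"
proof -
  note [measurable] = laplace_density_measurable [OF p]
  define D where "D = (\<integral>w. of_real w * (exp (z * of_real w) * of_real (p w)) \<partial>lborel)"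
  define C where "C = (\<integral>w. \<bar>w\<bar> ^ 2 * (exp (Re z / 2 * w) * \<bar>p w\<bar>) \<partial>lborel)"
  have bound: "norm (laplace p (z + k) - laplace p z - D * k) \<le> C * norm k ^ 2"
    if k: "norm k \<le> Re z / 2" for k
  proof -
    have Rek: "\<bar>Re k\<bar> \<le> Re z / 2"
      using k abs_Re_le_cmod [of k] by linarith
    then have "Re (z + k) > 0" using z by auto
    note i = integrable_laplace_moment [OF p this, of 0] integrable_laplace_moment [OF p z, of 0]
      integrable_laplace_moment [OF p z, of 1]
    have "laplace p (z + k) - laplace p z - D * k = (\<integral>w. (exp ((z + k) * of_real w) -
        exp (z * of_real w) - of_real w * exp (z * of_real w) * k) * of_real (p w) \<partial>lborel)"
      using i by (simp add: laplace_def D_def algebra_simps)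
    also have "norm \<dots> \<le> (\<integral>w. norm k ^ 2 * (\<bar>w\<bar> ^ 2 * (exp (Re z / 2 * w) * \<bar>p w\<bar>)) \<partial>lborel)"
    proof (rule Bochner_Integration.integral_norm_bound_integral)
      show "integrable lborel (\<lambda>w. norm k ^ 2 * (\<bar>w\<bar> ^ 2 * (exp (Re z / 2 * w) * \<bar>p w\<bar>)))"
        using laplace_density_moment [OF p, of "Re z / 2" 2] z by simp
      show "integrable lborel (\<lambda>w. (exp ((z + k) * of_real w) -
        exp (z * of_real w) - of_real w * exp (z * of_real w) * k) * complex_of_real (p w))"
        using i by (simp add: algebra_simps)
      fix w :: real
      show "norm ((exp ((z + k) * of_real w) - exp (z * of_real w) -
          of_real w * exp (z * of_real w) * k) * complex_of_real (p w))
        \<le> norm k ^ 2 * (\<bar>w\<bar> ^ 2 * (exp (Re z / 2 * w) * \<bar>p w\<bar>))"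
      proof (cases "w < 0")
        case True
        have "norm (exp (k * of_real w) - (1 + k * of_real w))
            \<le> exp \<bar>Re (k * of_real w)\<bar> * norm (k * of_real w) ^ 2"
          using Taylor_exp [of "k * of_real w" 1] by (simp add: numeral_2_eq_2)
        also have "\<dots> \<le> exp (- (Re z / 2 * w)) * norm (k * of_real w) ^ 2"
          using Rek True by (intro mult_right_mono) (auto simp: abs_mult mult_right_mono)
        finally have "norm (exp (z * of_real w)) * norm (exp (k * of_real w) - (1 + k * of_real w)) * \<bar>p w\<bar>
          \<le> exp (Re z * w) * (exp (- (Re z / 2 * w)) * norm (k * of_real w) ^ 2) * \<bar>p w\<bar>"
          by (intro mult_right_mono mult_mono) auto
        also have "\<dots> = norm k ^ 2 * (\<bar>w\<bar> ^ 2 * (exp (Re z * w + - (Re z / 2 * w)) * \<bar>p w\<bar>))"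
          unfolding exp_add by (simp add: norm_mult power_mult_distrib)
        also have "Re z * w + - (Re z / 2 * w) = Re z / 2 * w" by simp
        also have "norm (exp (z * of_real w)) * norm (exp (k * of_real w) - (1 + k * of_real w)) * \<bar>p w\<bar>
          = norm ((exp ((z + k) * of_real w) - exp (z * of_real w) -
              of_real w * exp (z * of_real w) * k) * complex_of_real (p w))"
        proof -
          have "(exp ((z + k) * of_real w) - exp (z * of_real w) -
              of_real w * exp (z * of_real w) * k) * complex_of_real (p w)
            = exp (z * of_real w) * (exp (k * of_real w) - (1 + k * of_real w)) * of_real (p w)"
            by (simp add: ring_distribs exp_add mult_ac)
          then show ?thesis by (simp only: norm_mult norm_of_real)
        qed
        finally show ?thesis .
      next
        case False
        then show ?thesis using p by (simp add: laplace_density_def)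
      qed
    qed
    finally show ?thesis by (simp add: C_def mult.commute)
  qed
  have "((\<lambda>k. (laplace p (z + k) - laplace p z) / k) \<longlongrightarrow> D) (at 0)"
  proof (rule LIM_zero_cancel, rule Lim_null_comparison)
    show "((\<lambda>k. C * norm k) \<longlongrightarrow> 0) (at 0)"
      by (auto intro!: tendsto_eq_intros)
    have "norm ((laplace p (z + k) - laplace p z) / k - D) \<le> C * norm k"
      if "k \<noteq> 0" "norm k \<le> Re z / 2" for k
    proof -
      have "norm ((laplace p (z + k) - laplace p z) / k - D)
          = norm (laplace p (z + k) - laplace p z - D * k) / norm k"
        using that by (simp add: norm_divide [symmetric] diff_divide_distrib)
      also have "\<dots> \<le> C * norm k ^ 2 / norm k"
        using bound [OF that(2)] by (intro divide_right_mono) auto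
      also have "\<dots> = C * norm k"
        using that by (simp add: power2_eq_square)
      finally show ?thesis .
    qed
    then show "\<forall>\<^sub>F k in at 0. norm ((laplace p (z + k) - laplace p z) / k - D) \<le> C * norm k"
      using z by (auto simp: eventually_at intro!: exI [of _ "Re z / 2"])
  qed
  then show ?thesis by (simp add: DERIV_def D_def)
qed

lemma laplace_holomorphic:
  assumes "laplace_density p"
  shows "laplace p holomorphic_on {z. Re z > 0}"
  unfolding holomorphic_on_def field_differentiable_def
  using has_field_derivative_laplace [OF assms] has_field_derivative_at_within by blast

lemma has_bochner_integral_laplace:
  assumes "laplace_density p" and "u > 0"
  shows "has_bochner_integral lborel (\<lambda>w. cos (v * w) * (exp (u * w) * p w))
      (Re (laplace p (Complex u v)))"
    and "has_bochner_integral lborel (\<lambda>w. sin (v * w) * (exp (u * w) * p w))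
      (Im (laplace p (Complex u v)))"
proof -
  have *: "has_bochner_integral lborel (\<lambda>w. exp (Complex u v * of_real w) * of_real (p w))
      (laplace p (Complex u v))"
    using integrable_laplace_moment [OF assms(1), of "Complex u v" 0] \<open>u > 0\<close>
    by (simp add: laplace_def has_bochner_integral_integrable)
  show "has_bochner_integral lborel (\<lambda>w. cos (v * w) * (exp (u * w) * p w))
      (Re (laplace p (Complex u v)))"
    using has_bochner_integral_bounded_linear [OF bounded_linear_Re *]
    by (simp add: Re_exp mult_ac)
  show "has_bochner_integral lborel (\<lambda>w. sin (v * w) * (exp (u * w) * p w))
      (Im (laplace p (Complex u v)))"
    using has_bochner_integral_bounded_linear [OF bounded_linear_Im *]
    by (simp add: Im_exp mult_ac)
qed

lemmas laplace_Re_Im = has_bochner_integral_laplace [THEN has_bochner_integral_integral_eq, symmetric]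

text \<open>
  By the identity theorem, since the positive reals accumulate inside the half-plane.
\<close>

lemma laplace_eq_of_eq_on_reals:
  assumes p: "laplace_density p" and q: "laplace_density q"
    and eq: "\<And>t. t > 0 \<Longrightarrow> laplace p (of_real t) = laplace q (of_real t)"
    and z: "Re z > 0"
  shows "laplace p z = laplace q z"
proof -
  have "laplace p z - laplace q z = 0"
  proof (rule analytic_continuation [where S = "{z. Re z > 0}" and U = "of_real ` {0<..}" and \<xi> = 1
        and f = "\<lambda>z. laplace p z - laplace q z"])
    show "(\<lambda>z. laplace p z - laplace q z) holomorphic_on {z. Re z > 0}"
      using p q by (intro holomorphic_intros laplace_holomorphic)
    show "open {z. Re z > 0}" by (rule open_halfspace_Re_gt)
    show "connected {z. Re z > 0}" by (intro convex_connected convex_halfspace_Re_gt)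
    show "(1 :: complex) islimpt of_real ` {0<..}"
      unfolding islimpt_approachable
    proof (intro allI impI)
      fix e :: real
      assume "e > 0"
      then show "\<exists>x'\<in>complex_of_real ` {0<..}. x' \<noteq> 1 \<and> dist x' 1 < e"
        by (intro bexI [of _ "of_real (1 + e / 2)"] imageI) (auto simp: dist_norm)
    qed
  qed (use eq z in auto)
  then show ?thesis by simp
qed

lemma measurable_laplace:
  assumes [measurable]: "p \<in> borel_measurable borel"
  shows "laplace p \<in> borel_measurable borel"
  unfolding laplace_def [abs_def] by measurable

lemma laplace_of_real_is_real:
  assumes "laplace_density p" and "t > 0"
  shows "Im (laplace p (of_real t)) = 0"
  using laplace_Re_Im(2) [OF assms, of 0] by (simp add: complex_of_real_def)

lemma integrable_neg_times_exp:
  assumes "a > 0"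
  shows "integrable lborel (\<lambda>w :: real. indicator {..<0} w * (- w * exp (a * w)))"
proof -
  have "integrable lborel (\<lambda>x :: real. indicator {0..} x * (x * exp (- x)))"
  proof (rule integrableI_bounded)
    have "(\<integral>\<^sup>+x. ennreal (norm (indicat_real {0..} x * (x * exp (- x)))) \<partial>lborel)
        = (\<integral>\<^sup>+x. ennreal (x ^ 1 * exp (- x)) * indicator {0 ..} x \<partial>lborel)"
      by (intro nn_integral_cong) (auto simp: indicator_def)
    also have "\<dots> < \<infinity>"
      by (subst nn_intergal_power_times_exp_Ici) auto
    finally show "(\<integral>\<^sup>+x. ennreal (norm (indicat_real {0..} x * (x * exp (- x)))) \<partial>lborel) < \<infinity>" .
  qed measurable
  then have "integrable lborel (\<lambda>w. indicator {0..} (0 + (- a) * w) * ((0 + (- a) * w) * exp (- (0 + (- a) * w))))"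
    using assms by (intro lborel_integrable_real_affine) auto
  then have "integrable lborel (\<lambda>w. (1 / a) * (indicator {0..} (- a * w) * ((- a * w) * exp (a * w))))"
    by (intro integrable_mult_right) simp
  also have "(\<lambda>w. (1 / a) * (indicator {0..} (- a * w) * ((- a * w) * exp (a * w))))
      = (\<lambda>w. indicator {..<0} w * (- w * exp (a * w)))"
    using assms by (auto simp: fun_eq_iff indicator_def mult_le_0_iff)
  finally show ?thesis .
qed

text \<open>
  Splitting \<open>exp (a w) |p w|\<close> as \<open>(sqrt (- w) exp (a w)) (|p w| / sqrt (- w))\<close>, both factors are
  square integrable.
\<close>

lemma laplace_density_if_weighted_L2:
  assumes [measurable]: "p \<in> borel_measurable borel" and zero: "\<And>w. w \<ge> 0 \<Longrightarrow> p w = 0"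
    and fin: "(\<integral>\<^sup>+w. ennreal ((p w)\<^sup>2 / (- w)) \<partial>lborel) < \<infinity>"
  shows "laplace_density p"
  unfolding laplace_density_def
proof (intro conjI allI impI)
  fix a :: real
  assume "a > 0"
  show "integrable lborel (\<lambda>w. exp (a * w) * p w)"
  proof (rule Bochner_Integration.integrable_bound)
    have "norm ((p w)\<^sup>2 / (- w)) = (p w)\<^sup>2 / (- w)" for w
      using zero [of w] by (cases "w \<ge> 0") (auto simp: divide_nonneg_neg)
    then have "integrable lborel (\<lambda>w. (p w)\<^sup>2 / (- w))"
      using fin by (simp add: integrable_iff_bounded)
    then show "integrable lborel (\<lambda>w. indicator {..<0} w * (- w * exp (2 * a * w)) + (p w)\<^sup>2 / (- w))"
      using \<open>a > 0\<close> by (intro Bochner_Integration.integrable_add integrable_neg_times_exp) auto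
    have "\<bar>exp (a * w) * p w\<bar> \<le> indicator {..<0} w * (- w * exp (2 * a * w)) + (p w)\<^sup>2 / (- w)" for w
    proof (cases "w < 0")
      case True
      define r where "r = sqrt (- w)"
      have r: "r > 0" "- w = r\<^sup>2" using True by (simp_all add: r_def)
      have "2 * ((r * exp (a * w)) * (\<bar>p w\<bar> / r)) \<le> (r * exp (a * w))\<^sup>2 + (\<bar>p w\<bar> / r)\<^sup>2"
        using sum_squares_bound [of "r * exp (a * w)" "\<bar>p w\<bar> / r"] by (simp only: mult.assoc)
      also have "(r * exp (a * w))\<^sup>2 = - w * exp (2 * a * w)"
        by (simp only: power_mult_distrib r(2) [symmetric] mult.assoc exp_double)
      also have "(\<bar>p w\<bar> / r)\<^sup>2 = (p w)\<^sup>2 / (- w)"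
        by (simp only: power_divide r(2) power2_abs)
      also have "(r * exp (a * w)) * (\<bar>p w\<bar> / r) = \<bar>exp (a * w) * p w\<bar>"
        using r(1) by (simp add: abs_mult)
      finally show ?thesis using True by simp
    next
      case False
      then show ?thesis using zero [of w] by simp
    qed
    then show "AE w in lborel. norm (exp (a * w) * p w) \<le>
        norm (indicator {..<0} w * (- w * exp (2 * a * w)) + (p w)\<^sup>2 / (- w))"
      by (intro AE_I2) (metis real_norm_def abs_ge_self order_trans)
  qed measurable
qed (rule zero)

lemma nn_integral_exp_half_line:
  fixes w :: real
  assumes "w < 0"
  shows "(\<integral>\<^sup>+u\<in>{0<..}. ennreal (exp (2 * u * w)) \<partial>lborel) \<le> ennreal (1 / (2 * (- w)))"
proof -
  have "(\<integral>\<^sup>+u\<in>{0<..}. ennreal (exp (2 * u * w)) \<partial>lborel)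
      \<le> (\<integral>\<^sup>+u. ennreal (exp (2 * u * w)) * indicator {0..} u \<partial>lborel)"
    by (intro nn_integral_mono) (auto simp: indicator_def)
  also have "\<dots> = ennreal (0 - exp (2 * 0 * w) / (2 * w))"
  proof (rule nn_integral_FTC_atLeast)
    show "((\<lambda>u. exp (2 * u * w) / (2 * w)) has_real_derivative exp (2 * u * w)) (at u)" for u
      using assms by (auto intro!: derivative_eq_intros)
    have "LIM u at_top. 2 * w * u :> at_bot"
      using assms by (intro filterlim_tendsto_neg_mult_at_bot [OF tendsto_const] filterlim_ident) simp
    then have "LIM u at_top. 2 * u * w :> at_bot"
      by (simp add: mult_ac)
    then have "((\<lambda>u. exp (2 * u * w)) \<longlongrightarrow> 0) at_top"
      by (rule filterlim_compose [OF exp_at_bot])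
    then show "((\<lambda>u. exp (2 * u * w) / (2 * w)) \<longlongrightarrow> 0) at_top"
      using tendsto_divide_zero by blast
  qed auto
  finally show ?thesis by simp
qed

text \<open>
  For fixed \<open>u\<close> the Laplace transform on the vertical line through \<open>u\<close> is the Fourier transform of
  \<open>exp (u w) p w\<close>.  After Plancherel, Tonelli allows the integral over \<open>u\<close> to be carried out first;
  the factors \<open>2 pi\<close> and \<open>1 / (- 2 w)\<close> combine to \<open>pi / (- w)\<close>.
\<close>

lemma laplace_bergman_bound:
  assumes p: "laplace_density p"
  shows "(\<integral>\<^sup>+u\<in>{0<..}. (\<integral>\<^sup>+v. ennreal ((norm (laplace p (Complex u v)))\<^sup>2) \<partial>lborel) \<partial>lborel)
    \<le> ennreal pi * (\<integral>\<^sup>+w. ennreal ((p w)\<^sup>2 / (- w)) \<partial>lborel)"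
proof -
  note [measurable] = laplace_density_measurable [OF p]
  have "(\<integral>\<^sup>+v. ennreal ((norm (laplace p (Complex u v)))\<^sup>2) \<partial>lborel)
      \<le> ennreal (2 * pi) * (\<integral>\<^sup>+w. ennreal (exp (2 * u * w) * (p w)\<^sup>2) \<partial>lborel)" if "u > 0" for u
  proof -
    have "integrable lborel (\<lambda>w. exp (u * w) * p w)"
      using p that by (simp add: laplace_density_def)
    moreover have "(norm (laplace p (Complex u v)))\<^sup>2 =
        (\<integral>w. cos (v * w) * (exp (u * w) * p w) \<partial>lborel)\<^sup>2 +
        (\<integral>w. sin (v * w) * (exp (u * w) * p w) \<partial>lborel)\<^sup>2" for v
      by (simp add: cmod_power2 laplace_Re_Im [OF p that])
    moreover have "exp (2 * u * w) * (p w)\<^sup>2 = (exp (u * w) * p w)\<^sup>2" for w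
      by (simp add: power_mult_distrib mult.assoc exp_double)
    ultimately show ?thesis
      using plancherel_inequality by simp
  qed
  then have "(\<integral>\<^sup>+v. ennreal ((norm (laplace p (Complex u v)))\<^sup>2) \<partial>lborel) * indicator {0<..} u
    \<le> (\<integral>\<^sup>+w. ennreal (2 * pi) * (ennreal ((p w)\<^sup>2) * (ennreal (exp (2 * u * w)) * indicator {0<..} u)) \<partial>lborel)" for u
    by (cases "u > 0") (simp_all add: nn_integral_cmult ennreal_mult mult.commute [of "ennreal ((p _)\<^sup>2)"])
  then have "(\<integral>\<^sup>+u\<in>{0<..}. (\<integral>\<^sup>+v. ennreal ((norm (laplace p (Complex u v)))\<^sup>2) \<partial>lborel) \<partial>lborel)
    \<le> (\<integral>\<^sup>+u. (\<integral>\<^sup>+w. ennreal (2 * pi) * (ennreal ((p w)\<^sup>2) * (ennreal (exp (2 * u * w)) * indicator {0<..} u)) \<partial>lborel) \<partial>lborel)"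
    by (rule nn_integral_mono)
  also have "\<dots> = (\<integral>\<^sup>+w. (\<integral>\<^sup>+u. ennreal (2 * pi) * (ennreal ((p w)\<^sup>2) * (ennreal (exp (2 * u * w)) * indicator {0<..} u)) \<partial>lborel) \<partial>lborel)"
    by (rule lborel_pair.Fubini') measurable
  also have "\<dots> = (\<integral>\<^sup>+w. ennreal (2 * pi) * (ennreal ((p w)\<^sup>2) * (\<integral>\<^sup>+u\<in>{0<..}. ennreal (exp (2 * u * w)) \<partial>lborel)) \<partial>lborel)"
    by (simp add: nn_integral_cmult)
  also have "\<dots> \<le> (\<integral>\<^sup>+w. ennreal pi * ennreal ((p w)\<^sup>2 / (- w)) \<partial>lborel)"
  proof (intro nn_integral_mono)
    fix w :: real
    show "ennreal (2 * pi) * (ennreal ((p w)\<^sup>2) * (\<integral>\<^sup>+u\<in>{0<..}. ennreal (exp (2 * u * w)) \<partial>lborel))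
      \<le> ennreal pi * ennreal ((p w)\<^sup>2 / (- w))"
    proof (cases "w < 0")
      case True
      have "ennreal (2 * pi) * (ennreal ((p w)\<^sup>2) * (\<integral>\<^sup>+u\<in>{0<..}. ennreal (exp (2 * u * w)) \<partial>lborel))
        \<le> ennreal (2 * pi) * (ennreal ((p w)\<^sup>2) * ennreal (1 / (2 * (- w))))"
        using nn_integral_exp_half_line [OF True] by (intro mult_left_mono) auto
      also have "\<dots> = ennreal (2 * pi * ((p w)\<^sup>2 * (1 / (2 * (- w)))))"
      proof -
        have nonneg: "0 \<le> 1 / (2 * (- w))"
          using True by simp
        have "ennreal ((p w)\<^sup>2) * ennreal (1 / (2 * (- w))) = ennreal ((p w)\<^sup>2 * (1 / (2 * (- w))))"
          by (rule ennreal_mult [OF zero_le_power2 nonneg, symmetric])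
        moreover have "ennreal (2 * pi) * ennreal ((p w)\<^sup>2 * (1 / (2 * (- w))))
            = ennreal (2 * pi * ((p w)\<^sup>2 * (1 / (2 * (- w)))))"
          by (rule ennreal_mult [OF _ mult_nonneg_nonneg [OF zero_le_power2 nonneg], symmetric]) simp
        ultimately show ?thesis by simp
      qed
      also have "2 * pi * ((p w)\<^sup>2 * (1 / (2 * (- w)))) = pi * ((p w)\<^sup>2 / (- w))"
        by simp
      also have "ennreal \<dots> = ennreal pi * ennreal ((p w)\<^sup>2 / (- w))"
        using True by (intro ennreal_mult) (auto simp: divide_nonneg_neg)
      finally show ?thesis .
    next
      case False
      then show ?thesis using p by (simp add: laplace_density_def)
    qed
  qed
  also have "\<dots> = ennreal pi * (\<integral>\<^sup>+w. ennreal ((p w)\<^sup>2 / (- w)) \<partial>lborel)"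
    by (rule nn_integral_cmult) measurable
  finally show ?thesis .
qed


section \<open>Left multiplication by an imaginary unit\<close>

lemmas cmult_add_left = bilinear_ladd [OF bilinear_cmult]
lemmas cmult_add_right = bilinear_radd [OF bilinear_cmult]
lemmas cmult_scaleR_left = bilinear_lmul [OF bilinear_cmult]
lemmas cmult_scaleR_right = bilinear_rmul [OF bilinear_cmult]
lemmas cmult_zero_right = bilinear_rzero [OF bilinear_cmult]
lemmas cmult_minus_left = bilinear_lneg [OF bilinear_cmult]

lemma bounded_bilinear_cmult: "bounded_bilinear (\<star>)"
  using bilinear_cmult bilinear_conv_bounded_bilinear by blast

lemma gen_cmult_nth:
  "(gen i \<star> b) $ C = blade_sign {i} (sym_diff {i} C) * b $ sym_diff {i} C"
proof -
  have swap: "C = sym_diff {i} B \<longleftrightarrow> B = sym_diff {i} C" for B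
    by blast
  have "gen i \<star> b = (\<Sum>B\<in>UNIV. (b $ B * blade_sign {i} B) *\<^sub>R blade (sym_diff {i} B))"
    by (subst clifford_expand [of b]) (simp add: cmult_sum_right cmult_scaleR_right blade_mult)
  then have "(gen i \<star> b) $ C = (\<Sum>B\<in>UNIV. if B = sym_diff {i} C then b $ B * blade_sign {i} B else 0)"
    by (simp add: blade_def axis_def swap if_distrib cong: if_cong)
  then show ?thesis by simp
qed

text \<open>
  A generator permutes the blades up to sign by toggling its index.  It squares to \<open>-1\<close>, so the signs
  for toggling back and forth are opposite.
\<close>

lemma gen_cmult_skew: "(gen i \<star> a) \<bullet> b = - (a \<bullet> (gen i \<star> b))"
proof -
  have sign: "blade_sign {i} (sym_diff {i} C) = - blade_sign {i} C" for C :: "'a set"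
    unfolding blade_sign_right by (simp add: blade_sign_def)
  have bij: "bij (sym_diff {i})"
    by (rule involuntory_imp_bij) blast
  have inv: "sym_diff {i} (sym_diff {i} C) = C" for C
    by blast
  have "(gen i \<star> a) \<bullet> b
      = (\<Sum>C\<in>UNIV. - blade_sign {i} C * a $ sym_diff {i} C * b $ C)"
    by (simp only: inner_vec_def inner_real_def gen_cmult_nth sign)
  also have "\<dots> = (\<Sum>C\<in>UNIV. - blade_sign {i} (sym_diff {i} C) * a $ C * b $ sym_diff {i} C)"
    by (subst sum.reindex_bij_betw [OF bij, symmetric]) (simp only: inv)
  also have "\<dots> = - (a \<bullet> (gen i \<star> b))"
    by (simp add: inner_vec_def gen_cmult_nth sum_negf mult_ac)
  finally show ?thesis .
qed

lemma imag_unit_cmult_skew: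
  assumes "I \<in> imag_units"
  shows "(I \<star> a) \<bullet> b = - (a \<bullet> (I \<star> b))"
proof -
  obtain x where "I = (\<Sum>i\<in>UNIV. x i *\<^sub>R gen i)"
    using assms by (auto simp: imag_units_def)
  then show ?thesis
    by (simp add: cmult_sum_left cmult_scaleR_left inner_sum_left inner_sum_right gen_cmult_skew
        sum_negf)
qed

lemma inner_imag_unit_cmult [simp]:
  assumes "I \<in> imag_units"
  shows "b \<bullet> (I \<star> b) = 0"
  using imag_unit_cmult_skew [OF assms, of b b] by (simp add: inner_commute)

lemma imag_unit_cmult_twice:
  assumes "I \<in> imag_units"
  shows "I \<star> (I \<star> b) = - b"
  by (simp add: cmult_assoc [symmetric] imag_unit_square [OF assms] cmult_minus_left)

text \<open>
  A skew map with square \<open>-1\<close> is orthogonal.  The coefficient norm is not multiplicative in general,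
  so this is special to imaginary units.
\<close>

lemma norm_imag_unit_cmult:
  assumes "I \<in> imag_units"
  shows "norm (I \<star> b) = norm b"
  using imag_unit_cmult_skew [OF assms, of b "I \<star> b"]
  by (simp add: imag_unit_cmult_twice [OF assms] norm_eq_sqrt_inner)

lemma norm_slice_pt:
  assumes "I \<in> imag_units"
  shows "norm (slice_pt I u v) = norm (Complex u v)"
proof -
  have "orthogonal (u *\<^sub>R cliff_one) (v *\<^sub>R (I \<star> cliff_one))"
    using inner_imag_unit_cmult [OF assms, of cliff_one] by (simp add: orthogonal_def)
  then have "(norm (u *\<^sub>R cliff_one + v *\<^sub>R (I \<star> cliff_one)))\<^sup>2
      = u\<^sup>2 * (norm (cliff_one :: 'a clifford))\<^sup>2 + v\<^sup>2 * (norm (I \<star> cliff_one))\<^sup>2"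
    by (simp only: norm_add_Pythagorean norm_scaleR power_mult_distrib power2_abs)
  also have "\<dots> = (norm (Complex u v))\<^sup>2"
    unfolding norm_imag_unit_cmult [OF assms] by (simp add: cmod_power2 blade_def)
  finally show ?thesis by (simp add: slice_pt_def)
qed

lemma norm_imag_unit:
  assumes "I \<in> imag_units"
  shows "norm I = 1"
  using norm_slice_pt [OF assms, of 0 1] by (simp add: slice_pt_def complex_norm)

text \<open>
  There is at least one generator, because index types are nonempty.
\<close>

lemma imag_units_nonempty: "imag_units \<noteq> ({} :: 'n::{finite,linorder} clifford set)"
proof -
  define x :: "'n \<Rightarrow> real" where "x i = (if i = undefined then 1 else 0)" for i
  have "(\<Sum>i\<in>UNIV. (x i)\<^sup>2) = 1"
    by (simp add: x_def if_distrib [of "\<lambda>t. t\<^sup>2"] cong: if_cong)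
  then have "(\<Sum>i\<in>UNIV. x i *\<^sub>R gen i) \<in> imag_units"
    unfolding imag_units_def by blast
  then show ?thesis by blast
qed

lemma uminus_imag_unit:
  assumes "I \<in> imag_units"
  shows "- I \<in> imag_units"
proof -
  obtain x where "I = (\<Sum>i\<in>UNIV. x i *\<^sub>R gen i)" "(\<Sum>i\<in>UNIV. (x i)\<^sup>2) = 1"
    using assms by (auto simp: imag_units_def)
  then show ?thesis
    unfolding imag_units_def by (auto intro!: exI [of _ "\<lambda>i. - x i"] simp: sum_negf)
qed

lemma slice_pt_uminus: "slice_pt (- I) u v = slice_pt I u (- v)"
  by (simp add: slice_pt_def)

lemma slice_pt_scalar_part:
  assumes "I \<in> imag_units"
  shows "slice_pt I u v $ {} = u"
  using assms by (auto simp: imag_units_def slice_pt_def blade_def axis_def)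

lemma slice_pt_in_half_space:
  assumes "I \<in> imag_units"
  shows "slice_pt I u v \<in> half_space \<longleftrightarrow> u > 0"
proof
  assume "slice_pt I u v \<in> half_space"
  then show "u > 0"
    using slice_pt_scalar_part [OF assms, of u v] by (simp add: half_space_eq)
qed (use assms in \<open>auto simp: half_space_def\<close>)


section \<open>Slice functions induced by holomorphic stem functions\<close>

definition vec_Re :: "complex ^ 'm \<Rightarrow> real ^ 'm" where
  "vec_Re c = (\<chi> A. Re (c $ A))"

definition vec_Im :: "complex ^ 'm \<Rightarrow> real ^ 'm" where
  "vec_Im c = (\<chi> A. Im (c $ A))"

lemma norm_vec_Re_Im: "(norm c)\<^sup>2 = (norm (vec_Re c))\<^sup>2 + (norm (vec_Im c))\<^sup>2"
  by (simp add: norm_vec_def L2_set_def sum_nonneg cmod_power2 sum.distrib vec_Re_def vec_Im_def)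

lemma bounded_linear_vec_Re: "bounded_linear vec_Re"
proof -
  have "linear (vec_Re :: complex ^ 'm \<Rightarrow> _)"
    by (auto intro!: linearI simp: vec_Re_def vec_eq_iff)
  then show "bounded_linear (vec_Re :: complex ^ 'm \<Rightarrow> _)"
    by (simp add: linear_conv_bounded_linear)
qed

lemma bounded_linear_vec_Im: "bounded_linear vec_Im"
proof -
  have "linear (vec_Im :: complex ^ 'm \<Rightarrow> _)"
    by (auto intro!: linearI simp: vec_Im_def vec_eq_iff)
  then show "bounded_linear (vec_Im :: complex ^ 'm \<Rightarrow> _)"
    by (simp add: linear_conv_bounded_linear)
qed

text \<open>
  A vector of complex coefficients is an element \<open>a + \<i> b\<close> of the complexified algebra.  This map
  replaces the formal \<open>\<i>\<close>, which commutes with everything, by \<open>I\<close> acting from the left.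
\<close>

definition stem_value ::
    "'n::{finite,linorder} clifford \<Rightarrow> complex ^ 'n set \<Rightarrow> 'n clifford" where
  "stem_value I c = vec_Re c + I \<star> vec_Im c"

lemma bounded_linear_stem_value: "bounded_linear (stem_value I)"
  unfolding stem_value_def
  by (intro bounded_linear_add bounded_linear_vec_Re
      bounded_linear_compose [OF bounded_bilinear.bounded_linear_right [OF bounded_bilinear_cmult]]
      bounded_linear_vec_Im)

text \<open>
  Complex linearity, with \<open>I\<close> acting on the target as the imaginary unit.  The Cauchy-Riemann equation
  on the slices comes from here.
\<close>

lemma stem_value_i:
  assumes "I \<in> imag_units"
  shows "stem_value I (\<chi> A. \<i> * c $ A) = I \<star> stem_value I c"
proof -
  have "vec_Re (\<chi> A. \<i> * c $ A) = - vec_Im c" "vec_Im (\<chi> A. \<i> * c $ A) = vec_Re c"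
    by (simp_all add: vec_Re_def vec_Im_def vec_eq_iff)
  then show ?thesis
    by (simp add: stem_value_def cmult_add_right imag_unit_cmult_twice [OF assms])
qed

lemma stem_value_real_multiple:
  "stem_value I (\<chi> A. of_real (d $ A) * z) = slice_pt I (Re z) (Im z) \<star> d"
proof -
  have "vec_Re (\<chi> A. of_real (d $ A) * z) = Re z *\<^sub>R d" "vec_Im (\<chi> A. of_real (d $ A) * z) = Im z *\<^sub>R d"
    by (simp_all add: vec_Re_def vec_Im_def vec_eq_iff)
  then show ?thesis
    by (simp add: stem_value_def slice_pt_def cmult_add_left cmult_scaleR_left cmult_scaleR_right)
qed

lemma norm_stem_value_le:
  assumes "I \<in> imag_units"
  shows "norm (stem_value I c) \<le> 2 * norm c"
proof -
  have "norm (vec_Re c) \<le> norm c" "norm (vec_Im c) \<le> norm c"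
    by (rule power2_le_imp_le; simp add: norm_vec_Re_Im [of c])+
  then show ?thesis
    unfolding stem_value_def
    using norm_triangle_ineq [of "vec_Re c" "I \<star> vec_Im c"] by (simp add: norm_imag_unit_cmult [OF assms])
qed

text \<open>
  For a single \<open>I\<close> the norm of the value differs from that of \<open>c\<close> by the mixed term between
  \<open>Re c\<close> and \<open>I Im c\<close>, which changes sign with \<open>I\<close>.
\<close>

lemma norm_stem_value_parallelogram:
  assumes "I \<in> imag_units"
  shows "(norm (stem_value I c))\<^sup>2 + (norm (stem_value (- I) c))\<^sup>2 = 2 * (norm c)\<^sup>2"
proof -
  have "(norm (a + b))\<^sup>2 + (norm (a - b))\<^sup>2 = 2 * ((norm a)\<^sup>2 + (norm b)\<^sup>2)" for a b :: "'a clifford"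
    by (simp add: power2_norm_eq_inner inner_add_left inner_add_right inner_diff_left inner_diff_right
        inner_commute)
  from this [of "vec_Re c" "I \<star> vec_Im c"] show ?thesis
    by (simp add: stem_value_def cmult_minus_left norm_imag_unit_cmult [OF assms] norm_vec_Re_Im)
qed

lemma has_derivative_vecI:
  fixes f :: "'a::euclidean_space \<Rightarrow> 'b::euclidean_space ^ 'm"
  assumes "\<And>A. ((\<lambda>x. f x $ A) has_derivative (\<lambda>k. f' k $ A)) F"
  shows "(f has_derivative f') F"
proof -
  have lin: "linear (\<lambda>k. f' k $ A)" for A
    using assms [of A] by (simp add: has_derivative_def bounded_linear.linear)
  have "linear f'"
    using linear_add [OF lin] linear_scale [OF lin] by (intro linearI) (auto simp: vec_eq_iff)
  moreover have "((\<lambda>y. (1 / norm (y - Lim F (\<lambda>x. x))) *\<^sub>R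
      ((f y - f (Lim F (\<lambda>x. x))) - f' (y - Lim F (\<lambda>x. x)))) \<longlongrightarrow> 0) F"
    using assms by (intro vec_tendstoI) (simp add: has_derivative_def divide_inverse)
  ultimately show ?thesis
    by (simp add: has_derivative_def linear_conv_bounded_linear divide_inverse)
qed

lemma real_derivative_of_real_on_reals:
  assumes f: "(f has_field_derivative D) (at (of_real u))" and "u > 0"
    and real: "\<And>t. t > 0 \<Longrightarrow> Im (f (of_real t)) = 0"
  shows "Im D = 0"
proof -
  have "((\<lambda>t. f (of_real t)) has_vector_derivative D) (at u)"
    by (rule has_vector_derivative_real_field [OF f])
  then have "((\<lambda>t. Im (f (of_real t))) has_vector_derivative Im D) (at u)"
    by (rule bounded_linear.has_vector_derivative [OF bounded_linear_Im])
  moreover have "((\<lambda>t. Im (f (of_real t))) has_vector_derivative 0) (at u)"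
    by (rule has_vector_derivative_transform_within_open [of "\<lambda>_. 0" _ _ "{0<..}"])
      (use assms in auto)
  ultimately show ?thesis
    by (rule vector_derivative_unique_at)
qed

text \<open>
  The function \<open>f\<close> is the slice function induced by the holomorphic stem function \<open>H\<close>.  The
  symmetry of stem functions under complex conjugation is implicit in the second axiom: \<open>u + I v\<close> and
  \<open>u + (- I) (- v)\<close> are the same point, so both representations must give the same value.
\<close>

locale stem_function =
  fixes H :: "complex \<Rightarrow> complex ^ 'n::{finite,linorder} set"
    and f :: "'n clifford \<Rightarrow> 'n clifford"
  assumes holo: "\<And>A. (\<lambda>z. H z $ A) holomorphic_on {z. Re z > 0}"
    and f: "\<And>I u v. I \<in> imag_units \<Longrightarrow> u > 0 \<Longrightarrow> f (slice_pt I u v) = stem_value I (H (Complex u v))"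
begin

definition stem_deriv :: "complex \<Rightarrow> complex ^ 'n set" where
  "stem_deriv z = (\<chi> A. deriv (\<lambda>z. H z $ A) z)"

lemma has_field_derivative_H:
  assumes "Re z > 0"
  shows "((\<lambda>z. H z $ A) has_field_derivative stem_deriv z $ A) (at z)"
  using holomorphic_derivI [OF holo open_halfspace_Re_gt, of z A] assms by (simp add: stem_deriv_def)

lemma has_derivative_H:
  assumes "Re z > 0"
  shows "(H has_derivative (\<lambda>k. \<chi> A. stem_deriv z $ A * k)) (at z)"
  using has_field_derivative_H [OF assms]
  by (intro has_derivative_vecI) (simp add: has_field_derivative_def)

text \<open>
  A real point lies on the slices of both \<open>I\<close> and \<open>- I\<close>, and the two representations of \<open>f\<close> there
  differ by the sign of the imaginary part.
\<close>

lemma H_real: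
  assumes I: "(I :: 'n clifford) \<in> imag_units" and "u > 0"
  shows "vec_Im (H (of_real u)) = 0"
proof -
  have "stem_value I (H (of_real u)) = stem_value (- I) (H (of_real u))"
    using f [OF I \<open>u > 0\<close>, of 0] f [OF uminus_imag_unit [OF I] \<open>u > 0\<close>, of 0]
    by (simp add: slice_pt_uminus complex_of_real_def)
  then have "2 *\<^sub>R (I \<star> vec_Im (H (of_real u))) = 0"
    by (simp add: stem_value_def cmult_minus_left scaleR_2 eq_neg_iff_add_eq_0)
  then show ?thesis
    using norm_imag_unit_cmult [OF I, of "vec_Im (H (of_real u))"] by simp
qed

lemma stem_deriv_real:
  assumes I: "(I :: 'n clifford) \<in> imag_units" and "u > 0"
  shows "Im (stem_deriv (of_real u) $ A) = 0"
proof (rule real_derivative_of_real_on_reals [OF has_field_derivative_H \<open>u > 0\<close>])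
  show "Im (H (of_real t) $ A) = 0" if "t > 0" for t
    using H_real [OF I that] by (simp add: vec_Im_def vec_eq_iff)
qed (use \<open>u > 0\<close> in simp)

lemma has_vector_derivative_slice:
  assumes I: "I \<in> imag_units" and "u > 0"
  shows "((\<lambda>s. f (slice_pt I s v)) has_vector_derivative stem_value I (stem_deriv (Complex u v))) (at u)"
    and "((\<lambda>t. f (slice_pt I u t)) has_vector_derivative I \<star> stem_value I (stem_deriv (Complex u v))) (at v)"
proof -
  have d: "(stem_value I \<circ> H has_derivative (\<lambda>k. stem_value I (\<chi> A. stem_deriv (Complex u v) $ A * k)))
      (at (Complex u v))"
    using diff_chain_at [OF has_derivative_H bounded_linear_imp_has_derivative
        [OF bounded_linear_stem_value]] \<open>u > 0\<close>
    by (simp add: o_def)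
  have path: "((\<lambda>s. Complex s v) has_vector_derivative 1) (at u)"
      "((\<lambda>t. Complex u t) has_vector_derivative \<i>) (at v)"
    unfolding Complex_eq by (auto intro!: derivative_eq_intros simp: has_vector_derivative_of_real)
  have 1: "((\<lambda>s. stem_value I (H (Complex s v))) has_vector_derivative
      stem_value I (stem_deriv (Complex u v))) (at u)"
    using vector_derivative_diff_chain_within [OF path(1) has_derivative_at_withinI [OF d]]
    by (simp add: o_def)
  show "((\<lambda>s. f (slice_pt I s v)) has_vector_derivative stem_value I (stem_deriv (Complex u v))) (at u)"
    using \<open>u > 0\<close>
    by (intro has_vector_derivative_transform_within_open [OF 1, of "{0<..}"]) (auto simp: f [OF I])
  have "((\<lambda>t. stem_value I (H (Complex u t))) has_vector_derivative
      I \<star> stem_value I (stem_deriv (Complex u v))) (at v)"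
    using vector_derivative_diff_chain_within [OF path(2) has_derivative_at_withinI [OF d]]
    by (simp add: o_def mult.commute stem_value_i [OF I])
  then show "((\<lambda>t. f (slice_pt I u t)) has_vector_derivative I \<star> stem_value I (stem_deriv (Complex u v))) (at v)"
    using \<open>u > 0\<close> by (simp add: f [OF I])
qed

lemma slice_dbar_eq_0:
  assumes "I \<in> imag_units" and "u > 0"
  shows "slice_dbar I f u v = 0"
  using has_vector_derivative_slice [OF assms, THEN vector_derivative_at]
  by (simp add: slice_dbar_def imag_unit_cmult_twice [OF assms(1)])

text \<open>
  Near a real point all slices meet, so a formula on one slice does not suffice.  The derivative of \<open>H\<close>
  at a real point is a real vector \<open>d\<close>; hence on every slice the linear part of \<open>f\<close> is the same map
  \<open>x \<mapsto> x \<star> d\<close>, and the error of the complex expansion bounds that of \<open>f\<close> with a constant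
  independent of the slice.
\<close>

lemma differentiable_at_real_point:
  assumes I: "I \<in> imag_units" and "u > 0"
  shows "f differentiable (at (slice_pt I u 0) within half_space)"
proof -
  define d where "d = vec_Re (stem_deriv (of_real u))"
  have D: "stem_deriv (of_real u) $ A = of_real (d $ A)" for A
    using stem_deriv_real [OF assms, of A] by (simp add: d_def vec_Re_def complex_eq_iff)
  have "(f has_derivative (\<lambda>x. x \<star> d)) (at (slice_pt I u 0) within half_space)"
    unfolding has_derivative_within_alt
  proof (intro conjI allI impI)
    show "bounded_linear (\<lambda>x. x \<star> d)"
      by (rule bounded_bilinear.bounded_linear_left [OF bounded_bilinear_cmult])
    fix e :: real
    assume "e > 0"
    moreover have "(H has_derivative (\<lambda>k. \<chi> A. of_real (d $ A) * k)) (at (of_real u))"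
      using has_derivative_H [of "of_real u"] \<open>u > 0\<close> by (simp add: D)
    ultimately obtain r where "r > 0" and r: "\<And>z. norm (z - of_real u) < r \<Longrightarrow>
        norm (H z - H (of_real u) - (\<chi> A. of_real (d $ A) * (z - of_real u)))
          \<le> e / 2 * norm (z - of_real u)"
      unfolding has_derivative_within_alt by (meson UNIV_I half_gt_zero)
    have "norm (f x - f (slice_pt I u 0) - (x - slice_pt I u 0) \<star> d) \<le> e * norm (x - slice_pt I u 0)"
      if x: "x \<in> half_space" "norm (x - slice_pt I u 0) < r" for x
    proof -
      obtain J s t where J: "J \<in> imag_units" and "s > 0" and xJ: "x = slice_pt J s t"
        using x(1) by (auto simp: half_space_def)
      have u: "slice_pt I u 0 = slice_pt J u 0"
        by (simp add: slice_pt_def)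
      have diff: "x - slice_pt J u 0 = slice_pt J (s - u) t"
        by (simp add: xJ slice_pt_def algebra_simps)
      let ?z = "Complex s t"
      have z: "?z - of_real u = Complex (s - u) t"
        by (simp add: complex_eq_iff)
      have norm: "norm (x - slice_pt J u 0) = norm (?z - of_real u)"
        by (simp add: diff norm_slice_pt [OF J] z)
      have "f x - f (slice_pt J u 0) - (x - slice_pt J u 0) \<star> d
        = stem_value J (H ?z) - stem_value J (H (of_real u))
          - stem_value J (\<chi> A. of_real (d $ A) * (?z - of_real u))"
        by (simp add: xJ [symmetric] diff stem_value_real_multiple z complex_of_real_def [symmetric]
            f [OF J \<open>u > 0\<close>]) (simp add: xJ f [OF J \<open>s > 0\<close>])
      also have "\<dots> = stem_value J (H ?z - H (of_real u) - (\<chi> A. of_real (d $ A) * (?z - of_real u)))"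
        by (simp only: linear_diff [OF bounded_linear.linear [OF bounded_linear_stem_value]])
      finally have "norm (f x - f (slice_pt J u 0) - (x - slice_pt J u 0) \<star> d)
          \<le> 2 * norm (H ?z - H (of_real u) - (\<chi> A. of_real (d $ A) * (?z - of_real u)))"
        using norm_stem_value_le [OF J] by simp
      also have "\<dots> \<le> 2 * (e / 2 * norm (?z - of_real u))"
        using r [of ?z] x(2) unfolding u norm by simp
      finally show ?thesis by (simp add: u norm)
    qed
    then show "\<exists>r>0. \<forall>x\<in>half_space. norm (x - slice_pt I u 0) < r \<longrightarrow>
        norm (f x - f (slice_pt I u 0) - (x - slice_pt I u 0) \<star> d) \<le> e * norm (x - slice_pt I u 0)"
      using \<open>r > 0\<close> by blast
  qed
  then show ?thesis by (rule differentiableI)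
qed

text \<open>
  With \<open>y\<close> the vector part of \<open>x\<close>, the point \<open>x\<close> lies on the slice of \<open>y / |y|\<close> at height \<open>|y|\<close>.
  Away from the real axis this exhibits \<open>f\<close> as a composition of differentiable maps.
\<close>

lemma closed_form:
  assumes "x \<in> half_space"
  defines "y \<equiv> x - x $ {} *\<^sub>R cliff_one"
  shows "f x = vec_Re (H (Complex (x $ {}) (norm y)))
    + (1 / norm y) *\<^sub>R (y \<star> vec_Im (H (Complex (x $ {}) (norm y))))"
proof -
  \<comment> \<open>Replacing \<open>J\<close> by \<open>- J\<close> if necessary, the height is nonnegative and hence equal to \<open>|y|\<close>.\<close>
  obtain J s t where J: "J \<in> imag_units" and "s > 0" and x: "x = slice_pt J s t" and "t \<ge> 0"
  proof -
    obtain J s t where J: "J \<in> imag_units" and s: "s > 0" and x: "x = slice_pt J s t"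
      using assms(1) by (auto simp: half_space_def)
    show thesis
    proof (cases "t \<ge> 0")
      case True
      show ?thesis by (rule that [OF J s x True])
    next
      case False
      show ?thesis
        by (rule that [OF uminus_imag_unit [OF J] s, of "- t"])
          (use False x in \<open>simp_all add: slice_pt_uminus\<close>)
    qed
  qed
  have "norm J = 1"
    by (rule norm_imag_unit [OF J])
  have s: "x $ {} = s"
    using slice_pt_scalar_part [OF J] x by simp
  then have y: "y = t *\<^sub>R J"
    by (simp add: y_def x slice_pt_def)
  then have "norm y = t"
    using \<open>t \<ge> 0\<close> \<open>norm J = 1\<close> by simp
  have "f x = stem_value J (H (Complex s t))"
    using f [OF J \<open>s > 0\<close>] x by simp
  \<comment> \<open>For \<open>t = 0\<close> the quotient is \<open>0\<close> by convention, which is right because \<open>H\<close> is real there.\<close>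
  also have "\<dots> = vec_Re (H (Complex s t)) + (1 / t) *\<^sub>R (y \<star> vec_Im (H (Complex s t)))"
    using H_real [OF J \<open>s > 0\<close>]
    by (cases "t = 0") (simp_all add: stem_value_def y cmult_scaleR_left complex_of_real_def cmult_zero_right)
  finally show ?thesis by (simp add: s \<open>norm y = t\<close>)
qed

lemma differentiable_at_nonreal_point:
  assumes I: "I \<in> imag_units" and "u > 0" and "v \<noteq> 0"
  shows "f differentiable (at (slice_pt I u v) within half_space)"
proof -
  let ?x = "slice_pt I u v"
  define y where "y x = x - x $ {} *\<^sub>R cliff_one" for x :: "'n clifford"
  have "norm I = 1"
    by (rule norm_imag_unit [OF I])
  have y_x: "y ?x = v *\<^sub>R I"
    using slice_pt_scalar_part [OF I] by (simp add: y_def) (simp add: slice_pt_def)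
  then have "y ?x \<noteq> 0"
    using \<open>v \<noteq> 0\<close> \<open>norm I = 1\<close> by auto
  have scalar: "(\<lambda>x. x $ {}) differentiable (at ?x)"
    by (rule bounded_linear_imp_differentiable) auto
  then have dy: "y differentiable (at ?x)"
    unfolding y_def by (intro derivative_intros) auto
  then have dn: "(\<lambda>x. norm (y x)) differentiable (at ?x)"
    using \<open>y ?x \<noteq> 0\<close> by (intro differentiable_compose [of norm y]) auto
  have of_real: "complex_of_real differentiable (at t)" for t
    by (intro bounded_linear_imp_differentiable bounded_linear_of_real)
  have dH: "(\<lambda>x. H (Complex (x $ {}) (norm (y x)))) differentiable (at ?x)"
  proof (rule differentiable_compose [of H "\<lambda>x. Complex (x $ {}) (norm (y x))"])
    show "H differentiable (at (Complex (?x $ {}) (norm (y ?x))))"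
      using \<open>u > 0\<close> by (intro differentiableI [OF has_derivative_H]) (simp add: slice_pt_scalar_part [OF I])
    show "(\<lambda>x. Complex (x $ {}) (norm (y x))) differentiable (at ?x)"
      unfolding Complex_eq
      by (intro differentiable_add differentiable_mult differentiable_const
          differentiable_compose [OF of_real scalar] differentiable_compose [OF of_real dn])
  qed
  have "(\<lambda>x. vec_Re (H (Complex (x $ {}) (norm (y x))))) differentiable (at ?x)"
      and dI: "(\<lambda>x. vec_Im (H (Complex (x $ {}) (norm (y x))))) differentiable (at ?x)"
    by (rule differentiable_compose [OF bounded_linear_imp_differentiable [OF bounded_linear_vec_Re] dH]
          differentiable_compose [OF bounded_linear_imp_differentiable [OF bounded_linear_vec_Im] dH])+
  moreover have "(\<lambda>x. y x \<star> vec_Im (H (Complex (x $ {}) (norm (y x))))) differentiable (at ?x)"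
    using dy dI bounded_bilinear.FDERIV [OF bounded_bilinear_cmult] unfolding differentiable_def by blast
  ultimately have "(\<lambda>x. vec_Re (H (Complex (x $ {}) (norm (y x)))) + (1 / norm (y x)) *\<^sub>R
      (y x \<star> vec_Im (H (Complex (x $ {}) (norm (y x)))))) differentiable (at ?x)"
    using dn \<open>y ?x \<noteq> 0\<close> by (intro derivative_intros) auto
  then have "(\<lambda>x. vec_Re (H (Complex (x $ {}) (norm (y x)))) + (1 / norm (y x)) *\<^sub>R
      (y x \<star> vec_Im (H (Complex (x $ {}) (norm (y x)))))) differentiable (at ?x within half_space)"
    by (rule differentiable_at_withinI)
  moreover have "?x \<in> half_space"
    using slice_pt_in_half_space [OF I] \<open>u > 0\<close> by simp
  ultimately show ?thesis
    by (rule differentiable_transform_within [OF _ zero_less_one]) (simp add: y_def closed_form)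
qed

theorem slice_monogenic: "f \<in> slice_monogenic half_space"
  unfolding slice_monogenic_def differentiable_on_def
proof (intro CollectI conjI ballI allI impI)
  fix x :: "'n clifford"
  assume "x \<in> half_space"
  then obtain I u v where "I \<in> imag_units" "u > 0" "x = slice_pt I u v"
    by (auto simp: half_space_def)
  then show "f differentiable (at x within half_space)"
    using differentiable_at_real_point differentiable_at_nonreal_point by (cases "v = 0") auto
next
  fix I :: "'n clifford" and u v
  assume "I \<in> imag_units" "slice_pt I u v \<in> half_space"
  then show "slice_dbar I f u v = 0"
    using slice_dbar_eq_0 slice_pt_in_half_space by blast
qed

lemma continuous_on_slice:
  assumes I: "I \<in> imag_units" and "u > 0"
  shows "continuous_on UNIV (\<lambda>v. f (slice_pt I u v))"
  using has_vector_derivative_slice(2) [OF assms]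
  by (intro continuous_at_imp_continuous_on ballI has_vector_derivative_continuous)

text \<open>
  Reflecting \<open>v\<close> does not change the integral and amounts to replacing \<open>I\<close> by \<open>- I\<close>, so the mixed
  terms cancel in the average and the integral does not depend on \<open>I\<close>.
\<close>

lemma slice_L2_norm:
  assumes I: "I \<in> imag_units" and "u > 0"
  shows "(\<integral>\<^sup>+v. ennreal ((norm (f (slice_pt I u v)))\<^sup>2) \<partial>lborel)
    = (\<integral>\<^sup>+v. ennreal ((norm (H (Complex u v)))\<^sup>2) \<partial>lborel)" (is "?N = ?R")
proof -
  have [measurable]: "(\<lambda>v. f (slice_pt I u v)) \<in> borel_measurable borel"
    using continuous_on_slice [OF assms] by (rule borel_measurable_continuous_onI)
  have "?N = (\<integral>\<^sup>+v. ennreal ((norm (f (slice_pt I u (- v))))\<^sup>2) \<partial>lborel)"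
    by (subst nn_integral_real_affine [where c = "- 1" and t = 0]) auto
  then have "2 * ?N = ?N + (\<integral>\<^sup>+v. ennreal ((norm (f (slice_pt I u (- v))))\<^sup>2) \<partial>lborel)"
    by (simp add: mult_2)
  also have "\<dots> = (\<integral>\<^sup>+v. ennreal ((norm (f (slice_pt I u v)))\<^sup>2)
      + ennreal ((norm (f (slice_pt I u (- v))))\<^sup>2) \<partial>lborel)"
    by (subst nn_integral_add) auto
  also have "\<dots> = (\<integral>\<^sup>+v. 2 * ennreal ((norm (H (Complex u v)))\<^sup>2) \<partial>lborel)"
  proof (intro nn_integral_cong)
    fix v :: real
    have "(norm (f (slice_pt I u v)))\<^sup>2 + (norm (f (slice_pt I u (- v))))\<^sup>2
        = 2 * (norm (H (Complex u v)))\<^sup>2"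
      using norm_stem_value_parallelogram [OF I] f [OF I \<open>u > 0\<close>]
        f [OF uminus_imag_unit [OF I] \<open>u > 0\<close>, of v] by (simp add: slice_pt_uminus)
    then show "ennreal ((norm (f (slice_pt I u v)))\<^sup>2) + ennreal ((norm (f (slice_pt I u (- v))))\<^sup>2)
        = 2 * ennreal ((norm (H (Complex u v)))\<^sup>2)"
      by (simp add: ennreal_mult flip: ennreal_plus)
  qed
  also have "\<dots> = 2 * ?R"
  proof (rule nn_integral_cmult)
    have "continuous (at v) (\<lambda>v. H (Complex u v))" for v
    proof (rule continuous_at_compose [unfolded o_def, of v "Complex u" H])
      show "continuous (at v) (Complex u)"
        unfolding Complex_eq by (intro continuous_intros)
      show "continuous (at (Complex u v)) H"
        using \<open>u > 0\<close> by (intro has_derivative_continuous [OF has_derivative_H]) simp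
    qed
    then have [measurable]: "(\<lambda>v. H (Complex u v)) \<in> borel_measurable borel"
      by (intro borel_measurable_continuous_onI continuous_at_imp_continuous_on) auto
    show "(\<lambda>v. ennreal ((norm (H (Complex u v)))\<^sup>2)) \<in> borel_measurable lborel"
      by measurable
  qed
  finally show ?thesis
    by (simp add: ennreal_mult_cancel_left)
qed

lemma bergman_norm_sq_eq:
  assumes I: "imag_units \<noteq> ({} :: 'n clifford set)"
  shows "bergman_norm_sq f =
    (\<integral>\<^sup>+u\<in>{0<..}. (\<integral>\<^sup>+v. ennreal ((norm (H (Complex u v)))\<^sup>2) \<partial>lborel) \<partial>lborel)"
proof -
  have "(\<integral>\<^sup>+u\<in>{0<..}. (\<integral>\<^sup>+v. ennreal ((norm (f (slice_pt I u v)))\<^sup>2) \<partial>lebesgue) \<partial>lebesgue)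
      = (\<integral>\<^sup>+u\<in>{0<..}. (\<integral>\<^sup>+v. ennreal ((norm (H (Complex u v)))\<^sup>2) \<partial>lborel) \<partial>lborel)"
    if "I \<in> imag_units" for I :: "'n clifford"
    unfolding nn_integral_completion
    by (intro nn_integral_cong) (auto simp: indicator_def slice_L2_norm [OF that])
  then show ?thesis
    unfolding bergman_norm_sq_def using I by simp
qed

end


section \<open>The transform of a weighted square integrable function\<close>

text \<open>
  Tonelli is applied to products of Lebesgue-Borel measure, so the Lebesgue measurable coefficient
  functions are replaced by Borel functions that agree with them almost everywhere.
\<close>

lemma weighted_L2_borel_components:
  fixes g :: "real \<Rightarrow> 'n::{finite,linorder} clifford"
  assumes "g \<in> weighted_L2"
  obtains p :: "'n set \<Rightarrow> real \<Rightarrow> real"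
    where "\<And>A. p A \<in> borel_measurable borel" "\<And>A w. w \<ge> 0 \<Longrightarrow> p A w = 0"
      "AE w in lborel. indicator {..<0} w *\<^sub>R g w = (\<chi> A. p A w)"
proof -
  have meas: "(\<lambda>w. indicator {..<0} w *\<^sub>R g w) \<in> borel_measurable lebesgue"
    using assms by (simp add: weighted_L2_def set_borel_measurable_def)
  have "\<exists>q \<in> borel_measurable lborel. AE w in lborel. (indicator {..<0} w *\<^sub>R g w) $ A = q w" for A
  proof (rule completion_ex_borel_measurable_real)
    show "(\<lambda>w. (indicator {..<0} w *\<^sub>R g w) $ A) \<in> borel_measurable lebesgue"
      by (rule measurable_compose [OF meas borel_measurable_continuous_onI])
        (intro continuous_intros)
  qed
  then obtain q where q: "\<And>A. q A \<in> borel_measurable lborel"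
    and eq: "\<And>A. AE w in lborel. (indicator {..<0} w *\<^sub>R g w) $ A = q A w"
    by metis
  have [measurable]: "q A \<in> borel_measurable borel" for A
    using q [of A] by simp
  define p where "p A w = indicator {..<0} w * q A w" for A and w :: real
  have "AE w in lborel. \<forall>A. (indicator {..<0} w *\<^sub>R g w) $ A = q A w"
    using eq by (intro AE_all_countable [THEN iffD2]) auto
  then have "AE w in lborel. indicator {..<0} w *\<^sub>R g w = (\<chi> A. p A w)"
    by eventually_elim (auto simp: vec_eq_iff p_def indicator_def)
  moreover have "p A \<in> borel_measurable borel" for A
    unfolding p_def by measurable
  moreover have "p A w = 0" if "w \<ge> 0" for A w
    using that by (simp add: p_def)
  ultimately show thesis using that by blast
qed

lemma weighted_norm_sq_components:
  fixes g :: "real \<Rightarrow> 'n::{finite,linorder} clifford"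
  assumes [measurable]: "\<And>A. p A \<in> borel_measurable borel" and zero: "\<And>A w. w \<ge> 0 \<Longrightarrow> p A w = 0"
    and eq: "AE w in lborel. indicator {..<0} w *\<^sub>R g w = (\<chi> A. p A w)"
  shows "weighted_norm_sq g = (\<Sum>A\<in>UNIV. \<integral>\<^sup>+w. ennreal ((p A w)\<^sup>2 / (- w)) \<partial>lborel)"
proof -
  have "weighted_norm_sq g = (\<integral>\<^sup>+w. (\<Sum>A\<in>UNIV. ennreal ((p A w)\<^sup>2 / (- w))) \<partial>lborel)"
    unfolding weighted_norm_sq_def nn_integral_completion
  proof (rule nn_integral_cong_AE)
    show "AE w in lborel. ennreal ((norm (g w))\<^sup>2 / (- w)) * indicator {..<0} w
        = (\<Sum>A\<in>UNIV. ennreal ((p A w)\<^sup>2 / (- w)))"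
      using eq
    proof eventually_elim
      case (elim w)
      show ?case
      proof (cases "w < 0")
        case True
        then have "g w = (\<chi> A. p A w)" using elim by simp
        then have "(norm (g w))\<^sup>2 / (- w) = (\<Sum>A\<in>UNIV. (p A w)\<^sup>2 / (- w))"
          by (simp add: norm_vec_def L2_set_def sum_nonneg sum_divide_distrib sum_negf)
        then show ?thesis
          using True by (simp add: sum_ennreal divide_nonneg_neg)
      qed (simp add: zero)
    qed
  qed
  then show ?thesis by (simp add: nn_integral_sum)
qed

text \<open>
  The kernel is \<open>exp (u w) (cos (v w) + I sin (v w))\<close>; its two parts, integrated against the
  coefficients, are the real and imaginary parts of the complex Laplace transforms.
\<close>

lemma slice_integral_eq_stem_value:
  fixes g :: "real \<Rightarrow> 'n::{finite,linorder} clifford"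
  assumes I: "I \<in> imag_units" and "u > 0"
    and g: "set_borel_measurable lebesgue {..<0} g"
    and p: "\<And>A. laplace_density (p A)"
    and eq: "AE w in lborel. indicator {..<0} w *\<^sub>R g w = (\<chi> A. p A w)"
  shows "(LINT w:{..<0}|lebesgue. cexp (w *\<^sub>R slice_pt I u v) \<star> g w)
    = stem_value I (\<chi> A. laplace (p A) (Complex u v))"
proof -
  note [measurable] = laplace_density_measurable [OF p]
  define a where "a w = cos (v * w) * exp (u * w)" for w
  define b where "b w = sin (v * w) * exp (u * w)" for w
  define G where "G w = indicator {..<0} w *\<^sub>R g w" for w
  have kernel: "indicator {..<0} w *\<^sub>R (cexp (w *\<^sub>R slice_pt I u v) \<star> g w)
      = a w *\<^sub>R G w + b w *\<^sub>R (I \<star> G w)" for w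
  proof -
    have "w *\<^sub>R slice_pt I u v = slice_pt I (w * u) (w * v)"
      by (simp add: slice_pt_def scaleR_add_right)
    then show ?thesis
      by (simp add: cexp_slice_pt(1) [OF I] a_def b_def G_def cmult_add_left cmult_scaleR_left
          cmult_scaleR_right scaleR_add_right mult_ac)
  qed
  have G_meas: "G \<in> borel_measurable lebesgue"
    using g by (simp add: set_borel_measurable_def G_def [abs_def])
  have IG_meas: "(\<lambda>w. I \<star> G w) \<in> borel_measurable lebesgue"
    by (rule measurable_compose [OF G_meas borel_measurable_continuous_onI])
      (auto intro!: linear_continuous_on bounded_bilinear.bounded_linear_right [OF bounded_bilinear_cmult])
  have [measurable]: "a \<in> borel_measurable borel" "b \<in> borel_measurable borel"
    unfolding a_def b_def by measurable
  have int: "has_bochner_integral lborel (\<lambda>w. a w * p A w) (Re (laplace (p A) (Complex u v)))"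
      "has_bochner_integral lborel (\<lambda>w. b w * p A w) (Im (laplace (p A) (Complex u v)))" for A
    using has_bochner_integral_laplace [OF p [of A] \<open>u > 0\<close>, of v] by (simp_all add: a_def b_def mult.assoc)
  have "(LINT w:{..<0}|lebesgue. cexp (w *\<^sub>R slice_pt I u v) \<star> g w)
      = (\<integral>w. a w *\<^sub>R G w + b w *\<^sub>R (I \<star> G w) \<partial>lebesgue)"
    by (simp only: set_lebesgue_integral_def kernel)
  also have "\<dots> = (\<integral>w. (\<Sum>A\<in>UNIV. (a w * p A w) *\<^sub>R blade A) + (\<Sum>A\<in>UNIV. (b w * p A w) *\<^sub>R (I \<star> blade A)) \<partial>lebesgue)"
  proof (rule integral_cong_AE)
    have "AE w in lborel. a w *\<^sub>R G w + b w *\<^sub>R (I \<star> G w) =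
        (\<Sum>A\<in>UNIV. (a w * p A w) *\<^sub>R blade A) + (\<Sum>A\<in>UNIV. (b w * p A w) *\<^sub>R (I \<star> blade A))"
      using eq
    proof eventually_elim
      case (elim w)
      have "G w = (\<Sum>A\<in>UNIV. p A w *\<^sub>R blade A)"
        unfolding G_def elim by (subst clifford_expand) simp
      then show ?case
        by (simp add: cmult_sum_right cmult_scaleR_right scaleR_sum_right)
    qed
    then show "AE w in lebesgue. a w *\<^sub>R G w + b w *\<^sub>R (I \<star> G w) =
        (\<Sum>A\<in>UNIV. (a w * p A w) *\<^sub>R blade A) + (\<Sum>A\<in>UNIV. (b w * p A w) *\<^sub>R (I \<star> blade A))"
      by (rule AE_completion)
    have "a \<in> borel_measurable lebesgue" "b \<in> borel_measurable lebesgue"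
      by (intro measurable_completion; simp)+
    then show "(\<lambda>w. a w *\<^sub>R G w + b w *\<^sub>R (I \<star> G w)) \<in> borel_measurable lebesgue"
      by (intro borel_measurable_add borel_measurable_scaleR G_meas IG_meas)
    show "(\<lambda>w. (\<Sum>A\<in>UNIV. (a w * p A w) *\<^sub>R blade A) + (\<Sum>A\<in>UNIV. (b w * p A w) *\<^sub>R (I \<star> blade A)))
        \<in> borel_measurable lebesgue"
      by (rule measurable_completion) measurable
  qed
  also have "\<dots> = (\<integral>w. (\<Sum>A\<in>UNIV. (a w * p A w) *\<^sub>R blade A) + (\<Sum>A\<in>UNIV. (b w * p A w) *\<^sub>R (I \<star> blade A)) \<partial>lborel)"
    by (rule integral_completion) measurable
  also have "\<dots> = (\<Sum>A\<in>UNIV. Re (laplace (p A) (Complex u v)) *\<^sub>R blade A)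
      + (\<Sum>A\<in>UNIV. Im (laplace (p A) (Complex u v)) *\<^sub>R (I \<star> blade A))"
    by (intro has_bochner_integral_integral_eq has_bochner_integral_add has_bochner_integral_sum
        has_bochner_integral_scaleR_left int)
  also have "\<dots> = stem_value I (\<chi> A. laplace (p A) (Complex u v))"
    unfolding stem_value_def
    by (subst (1 2) clifford_expand) (simp add: vec_Re_def vec_Im_def cmult_sum_right cmult_scaleR_right)
  finally show ?thesis .
qed

lemma stem_laplace_bergman_bound:
  fixes p :: "'n::{finite,linorder} set \<Rightarrow> real \<Rightarrow> real"
  assumes p: "\<And>A. laplace_density (p A)"
  shows "(\<integral>\<^sup>+u\<in>{0<..}. (\<integral>\<^sup>+v. ennreal ((norm
      (\<chi> A. of_real (1 / sqrt (2 * pi)) * laplace (p A) (Complex u v)))\<^sup>2) \<partial>lborel) \<partial>lborel)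
    \<le> (\<Sum>A\<in>UNIV. \<integral>\<^sup>+w. ennreal ((p A w)\<^sup>2 / (- w)) \<partial>lborel) / 2"
proof -
  let ?L = "\<lambda>A u v. ennreal ((norm (laplace (p A) (Complex u v)))\<^sup>2)"
  have [measurable]: "(\<lambda>(u, v). laplace (p A) (Complex u v)) \<in> borel_measurable (lborel \<Otimes>\<^sub>M lborel)" for A
    using measurable_laplace [OF laplace_density_measurable [OF p [of A]]]
    unfolding Complex_eq by measurable
  have "ennreal ((norm (\<chi> A. of_real (1 / sqrt (2 * pi)) * laplace (p A) (Complex u v)))\<^sup>2)
      = ennreal (1 / (2 * pi)) * (\<Sum>A\<in>UNIV. ?L A u v)" for u v
  proof -
    have "(norm (\<chi> A. of_real (1 / sqrt (2 * pi)) * laplace (p A) (Complex u v)))\<^sup>2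
        = (\<Sum>A\<in>UNIV. 1 / (2 * pi) * (norm (laplace (p A) (Complex u v)))\<^sup>2)"
      by (simp add: norm_vec_def L2_set_def sum_nonneg norm_mult norm_divide power_divide)
    then show ?thesis
      by (simp add: ennreal_mult [symmetric] sum_nonneg sum_distrib_left [symmetric]
          del: times_divide_eq_left)
  qed
  then have "(\<integral>\<^sup>+v. ennreal ((norm
      (\<chi> A. of_real (1 / sqrt (2 * pi)) * laplace (p A) (Complex u v)))\<^sup>2) \<partial>lborel)
      = ennreal (1 / (2 * pi)) * (\<Sum>A\<in>UNIV. \<integral>\<^sup>+v. ?L A u v \<partial>lborel)" for u
    by (simp add: nn_integral_cmult nn_integral_sum del: sum_ennreal)
  then have "(\<integral>\<^sup>+u\<in>{0<..}. (\<integral>\<^sup>+v. ennreal ((norm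
      (\<chi> A. of_real (1 / sqrt (2 * pi)) * laplace (p A) (Complex u v)))\<^sup>2) \<partial>lborel) \<partial>lborel)
    = (\<integral>\<^sup>+u. ennreal (1 / (2 * pi)) * (\<Sum>A\<in>UNIV. (\<integral>\<^sup>+v. ?L A u v \<partial>lborel) * indicator {0<..} u) \<partial>lborel)"
    by (simp only: sum_distrib_right mult.assoc)
  also have "\<dots> = ennreal (1 / (2 * pi)) * (\<Sum>A\<in>UNIV. \<integral>\<^sup>+u\<in>{0<..}. (\<integral>\<^sup>+v. ?L A u v \<partial>lborel) \<partial>lborel)"
    by (subst nn_integral_cmult, measurable, subst nn_integral_sum, measurable)
  also have "\<dots> \<le> ennreal (1 / (2 * pi)) *
      (\<Sum>A\<in>UNIV. ennreal pi * (\<integral>\<^sup>+w. ennreal ((p A w)\<^sup>2 / (- w)) \<partial>lborel))"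
    by (intro mult_left_mono sum_mono laplace_bergman_bound p) auto
  also have "\<dots> = ennreal (1 / 2) * (\<Sum>A\<in>UNIV. \<integral>\<^sup>+w. ennreal ((p A w)\<^sup>2 / (- w)) \<partial>lborel)"
    by (simp add: sum_distrib_left [symmetric] mult.assoc [symmetric] ennreal_mult [symmetric])
  also have "ennreal (1 / 2) = inverse (ennreal 2)"
    by (simp only: inverse_ennreal zero_less_numeral inverse_eq_divide)
  also have "ennreal 2 = 2"
    by (rule ennreal_numeral)
  finally show ?thesis
    by (simp add: divide_ennreal_def mult.commute)
qed

theorem theorem3p20:
  fixes g :: "'n::{finite,linorder} clifford \<Rightarrow> real \<Rightarrow> 'n clifford"
    and f :: "'n clifford \<Rightarrow> 'n clifford"
  assumes g: "\<And>I. I \<in> imag_units \<Longrightarrow> g I \<in> weighted_L2"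
    and f: "\<And>I u v. I \<in> imag_units \<Longrightarrow> u > 0 \<Longrightarrow>
      f (slice_pt I u v) = (1 / sqrt (2 * pi)) *\<^sub>R
        (LINT w:{..<0}|lebesgue. cexp (w *\<^sub>R slice_pt I u v) \<star> g I w)"
  shows "f \<in> slice_bergman_space \<and>
    (\<forall>I\<in>imag_units. bergman_norm_sq f \<le> weighted_norm_sq (g I) / 2)"
proof -
  have "\<forall>I\<in>imag_units. \<exists>p. (\<forall>A. p A \<in> borel_measurable borel) \<and>
      (\<forall>A w. w \<ge> 0 \<longrightarrow> p A w = (0 :: real)) \<and>
      (AE w in lborel. indicator {..<0} w *\<^sub>R g I w = (\<chi> A. p A w))"
  proof
    fix I :: "'n clifford"
    assume "I \<in> imag_units"
    from g [OF this] show "\<exists>p. (\<forall>A. p A \<in> borel_measurable borel) \<and>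
      (\<forall>A w. w \<ge> 0 \<longrightarrow> p A w = (0 :: real)) \<and>
      (AE w in lborel. indicator {..<0} w *\<^sub>R g I w = (\<chi> A. p A w))"
      by (rule weighted_L2_borel_components) blast
  qed
  from bchoice [OF this] obtain p where "\<forall>I\<in>imag_units. (\<forall>A. p I A \<in> borel_measurable borel) \<and>
      (\<forall>A w. w \<ge> 0 \<longrightarrow> p I A w = (0 :: real)) \<and>
      (AE w in lborel. indicator {..<0} w *\<^sub>R g I w = (\<chi> A. p I A w))"
    by blast
  then have p: "\<And>A. p I A \<in> borel_measurable borel" "\<And>A w. w \<ge> 0 \<Longrightarrow> p I A w = 0"
      "AE w in lborel. indicator {..<0} w *\<^sub>R g I w = (\<chi> A. p I A w)" if "I \<in> imag_units" for I
    using that by auto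
  have norm_g: "weighted_norm_sq (g I) = (\<Sum>A\<in>UNIV. \<integral>\<^sup>+w. ennreal ((p I A w)\<^sup>2 / (- w)) \<partial>lborel)"
    if "I \<in> imag_units" for I
    by (rule weighted_norm_sq_components [OF p [OF that]])
  have dec: "laplace_density (p I A)" if I: "I \<in> imag_units" for I A
  proof (rule laplace_density_if_weighted_L2 [OF p(1,2) [OF I]])
    have "(\<integral>\<^sup>+w. ennreal ((p I A w)\<^sup>2 / (- w)) \<partial>lborel) \<le> weighted_norm_sq (g I)"
      unfolding norm_g [OF I]
      by (rule member_le_sum [of A UNIV "\<lambda>A. \<integral>\<^sup>+w. ennreal ((p I A w)\<^sup>2 / (- w)) \<partial>lborel"]) auto
    also have "\<dots> < \<infinity>"
      using g [OF I] by (simp add: weighted_L2_def)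
    finally show "(\<integral>\<^sup>+w. ennreal ((p I A w)\<^sup>2 / (- w)) \<partial>lborel) < \<infinity>" .
  qed
  define H where "H I z = (\<chi> A. of_real (1 / sqrt (2 * pi)) * laplace (p I A) z)" for I z
  have f_stem: "f (slice_pt I u v) = stem_value I (H I (Complex u v))"
    if I: "I \<in> imag_units" and "u > 0" for I u v
  proof -
    have "f (slice_pt I u v) = (1 / sqrt (2 * pi)) *\<^sub>R stem_value I (\<chi> A. laplace (p I A) (Complex u v))"
      using slice_integral_eq_stem_value [OF I \<open>u > 0\<close> _ dec [OF I] p(3) [OF I]] g [OF I]
      by (simp add: f [OF that] weighted_L2_def)
    also have "\<dots> = stem_value I ((1 / sqrt (2 * pi)) *\<^sub>R (\<chi> A. laplace (p I A) (Complex u v)))"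
      by (simp add: linear_scale [OF bounded_linear.linear [OF bounded_linear_stem_value]])
    also have "(1 / sqrt (2 * pi)) *\<^sub>R (\<chi> A. laplace (p I A) (Complex u v)) = H I (Complex u v)"
      by (simp add: H_def vec_eq_iff) (simp add: scaleR_conv_of_real)
    finally show ?thesis .
  qed
  \<comment> \<open>The slices share the positive real axis, where the stem functions are real and hence equal to
    the coefficients of \<open>f\<close>.\<close>
  have H_indep: "H I z = H J z" if I: "I \<in> imag_units" and J: "J \<in> imag_units" and z: "Re z > 0" for I J z
  proof -
    have "laplace (p I A) z = laplace (p J A) z" for A
    proof (rule laplace_eq_of_eq_on_reals [OF dec [OF I] dec [OF J] _ z])
      fix t :: real
      assume "t > 0"
      have Im: "vec_Im (H K (of_real t)) = 0" if "K \<in> imag_units" for K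
        by (simp add: H_def vec_Im_def vec_eq_iff laplace_of_real_is_real [OF dec [OF that] \<open>t > 0\<close>])
      have "stem_value I (H I (of_real t)) = stem_value J (H J (of_real t))"
        using f_stem [OF I \<open>t > 0\<close>, of 0] f_stem [OF J \<open>t > 0\<close>, of 0]
        by (simp add: complex_of_real_def slice_pt_def)
      then have "vec_Re (H I (of_real t)) = vec_Re (H J (of_real t))"
        by (simp add: stem_value_def Im I J cmult_zero_right)
      then have "Re (laplace (p I A) (of_real t)) = Re (laplace (p J A) (of_real t))"
        by (simp add: H_def vec_Re_def vec_eq_iff)
      then show "laplace (p I A) (of_real t) = laplace (p J A) (of_real t)"
        using \<open>t > 0\<close> by (simp add: complex_eq_iff laplace_of_real_is_real dec I J)
    qed
    then show ?thesis by (simp add: H_def)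
  qed
  have stem: "stem_function (H I) f" if I: "I \<in> imag_units" for I
  proof
    show "(\<lambda>z. H I z $ A) holomorphic_on {z. Re z > 0}" for A
      unfolding H_def vec_lambda_beta by (intro holomorphic_intros laplace_holomorphic dec I)
    show "f (slice_pt J u v) = stem_value J (H I (Complex u v))" if "J \<in> imag_units" "u > 0" for J u v
      using f_stem [OF that] H_indep [OF I that(1), of "Complex u v"] that(2) by simp
  qed
  have bound: "bergman_norm_sq f \<le> weighted_norm_sq (g I) / 2" if I: "I \<in> imag_units" for I
    using stem_laplace_bergman_bound [OF dec [OF I]]
      stem_function.bergman_norm_sq_eq [OF stem [OF I] imag_units_nonempty]
    by (simp only: H_def norm_g [OF I])
  obtain I :: "'n clifford" where I: "I \<in> imag_units"
    using imag_units_nonempty by blast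
  have "weighted_norm_sq (g I) / 2 < \<infinity>"
    using g [OF I]
    by (auto simp: weighted_L2_def divide_ennreal_def ennreal_mult_eq_top_iff less_top [symmetric])
  with bound [OF I] have "bergman_norm_sq f < \<infinity>"
    by (rule le_less_trans)
  then show ?thesis
    using stem_function.slice_monogenic [OF stem [OF I]] bound by (simp add: slice_bergman_space_def)
qed

end
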